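(* Let $b,\iota>0$, suppose $\sigma>2(\iota+b)$, and let $n\ge0$ be an integer. For $\lambda\in i\mathbb R$, the Cherednik-Opdam transforms of the Jacobi type functions $Q^{(0)}_{n,1}$ and $Q^{(0)}_{n,-1}$ are given by $$\mathcal F_{\pm1}(Q^{(0)}_{n,1})(\lambda)=\frac{(\sigma_0+1)_n}{n!}\,\widetilde{w_\sigma}(\lambda)\;{}_4F_3\!\left(-n,\;n+\sigma_0+\delta_0+1,\;\tfrac{\sigma-\rho+\lambda}{2},\;\tfrac{\sigma-\rho-\lambda}{2};\;\sigma_0+1,\;\tfrac{\sigma}{2},\;\tfrac{\sigma+1-\iota}{2};\;1\right)$$ and $$\mathcal F_{\pm1}(Q^{(0)}_{n,-1})(\lambda)=-\frac{(\sigma_0+1)_n}{n!\,\sigma}\,\widetilde{w_\sigma}(\lambda)\,(\pm\lambda+\rho)\;{}_4F_3\!\left(-n,\;n+\sigma_0+\delta_1+1,\;\tfrac{\sigma-\rho+\lambda}{2},\;\tfrac{\sigma-\rho-\lambda}{2};\;\sigma_0+1,\;\tfrac{\sigma}{2}+1,\;\tfrac{\sigma+1-\iota}{2};\;1\right).$$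
   Context: Put $\rho=b+\iota$ and $d\mu(t)=2^{2b+\iota}|\sinh t|^{2b}|\sinh(2t)|^{\iota}dt$ on $\mathbb R$. The hypergeometric series is ${}_pF_q(a_1,\dots,a_p;b_1,\dots,b_q;x)=\sum_{m\ge0}\frac{(a_1)_m\cdots(a_p)_m}{(b_1)_m\cdots(b_q)_m}\frac{x^m}{m!}$ with $(a)_m=a(a+1)\cdots(a+m-1)$; ${}_2F_1(\cdot,\cdot;\cdot;x)$ for $x\le 0$ is understood as the analytic continuation. For $\lambda\in i\mathbb R$ let $$G(\lambda,t)={}_2F_1\!\left(\tfrac{\lambda+\rho}{2},\tfrac{-\lambda+\rho}{2};\tfrac{1+\iota}{2}+b;-\sinh^2t\right)+\frac{1}{\lambda+\rho}\sinh(2t)\;{}_2F_1'\!\left(\tfrac{\lambda+\rho}{2},\tfrac{-\lambda+\rho}{2};\tfrac{1+\iota}{2}+b;-\sinh^2t\right),$$ where ${}_2F_1'$ is the derivative of ${}_2F_1$ with respect to its last argument. The Cherednik-Opdam transform of $f$ is $\mathcal Ff=(\mathcal F_1f,\mathcal F_{-1}f)$ with $$\mathcal F_{\pm1}f(\lambda)=\int_{\mathbb R}f(t)\,G(\lambda,\pm t)\,d\mu(t).$$ For even $f$ one has $\mathcal F_1f=\mathcal F_{-1}f=:\widetilde f$. Put $w_\sigma(t)=(\cosh t)^{-\sigma}$, so $\widetilde{w_\sigma}(\lambda)=\mathcal F_{\pm1}w_\sigma(\lambda)$, and $$\sigma_0=\sigma-(\iota+b+1),\qquad \delta_0=\frac{\iota-1}{2}+b,\qquad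 \delta_1=\delta_0+1 .$$ $P_n^{\alpha,\beta}$ denotes the Jacobi polynomial in the standard normalization $P_n^{\alpha,\beta}(1)=\frac{(\alpha+1)_n}{n!}$, orthogonal on $(-1,1)$ with respect to $(1-x)^\alpha(1+x)^\beta dx$. The Jacobi type functions (with $k=0$) are $$Q^{(0)}_{n,1}(t)=w_\sigma(t)\,P_n^{\sigma_0,\delta_0}(2\tanh^2t-1),\qquad Q^{(0)}_{n,-1}(t)=w_\sigma(t)\,P_n^{\sigma_0,\delta_1}(2\tanh^2t-1)\,\tanh t .$$
   Formalization: In the second formula the factor (±λ+ρ) is replaced by ±(λ−ρ): unchanged for the lower sign, λ−ρ instead of λ+ρ for the upper. The printed version fails at n=0, λ=0, since the function is odd, so its two transforms are negatives of each other. *)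

theory Defs
  imports "HOL-Complex_Analysis.Complex_Analysis"
begin

definition hypergeom :: "complex list \<Rightarrow> complex list \<Rightarrow> complex \<Rightarrow> complex" where
  "hypergeom as bs x = eval_fps (fps_hypergeo as bs 1) x"

lemma hypergeom_eq_suminf:
  "hypergeom as bs x =
     (\<Sum>m. (\<Prod>a\<leftarrow>as. pochhammer a m) / (\<Prod>b\<leftarrow>bs. pochhammer b m) * (x ^ m / fact m))"
proof -
  have foldl_mult: "foldl (\<lambda>r a. r * pochhammer a m) (c::complex) xs = c * (\<Prod>a\<leftarrow>xs. pochhammer a m)"
    for m c xs by (induction xs arbitrary: c) (simp_all add: mult.assoc)
  show ?thesis
    by (simp add: hypergeom_def eval_fps_def fps_hypergeo_nth foldl_mult del: foldl_mult_start)
qed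

(* Analytic continuation of the germ of g at 0 along the segment from 0 to z: a segment has
   arbitrarily small convex open neighbourhoods, and on a convex open set the continuation is
   unique (lemma below).  It exists for 2F1 with c not in {0,-1,-2,...} and z outside
   [1,infinity), where it gives the principal branch. *)
definition segment_continuation :: "(complex \<Rightarrow> complex) \<Rightarrow> complex \<Rightarrow> complex" where
  "segment_continuation g z =
     (THE w. \<exists>S f. open S \<and> convex S \<and> 0 \<in> S \<and> z \<in> S \<and> f holomorphic_on S \<and>
                   (\<forall>\<^sub>F u in nhds 0. f u = g u) \<and> w = f z)"

lemma segment_continuation_eqI:
  assumes "open S" "convex S" "0 \<in> S" "z \<in> S" "f holomorphic_on S"
    and "\<forall>\<^sub>F u in nhds 0. f u = g u"
  shows "segment_continuation g z = f z"
  unfolding segment_continuation_def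
proof (rule the_equality)
  show "\<exists>S h. open S \<and> convex S \<and> 0 \<in> S \<and> z \<in> S \<and> h holomorphic_on S \<and>
          (\<forall>\<^sub>F u in nhds 0. h u = g u) \<and> f z = h z"
    using assms by blast
next
  fix w
  assume "\<exists>S h. open S \<and> convex S \<and> 0 \<in> S \<and> z \<in> S \<and> h holomorphic_on S \<and>
          (\<forall>\<^sub>F u in nhds 0. h u = g u) \<and> w = h z"
  then obtain T h where T: "open T" "convex T" "0 \<in> T" "z \<in> T" "h holomorphic_on T"
    "\<forall>\<^sub>F u in nhds 0. h u = g u" "w = h z" by blast
  have "\<forall>\<^sub>F u in nhds 0. f u = h u"
    using eventually_conj[OF assms(6) T(6)] by (rule eventually_mono) simp
  then obtain U where U: "open U" "0 \<in> U" "\<And>u. u \<in> U \<Longrightarrow> f u = h u"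
    by (auto simp: eventually_nhds)
  have "f z = h z"
  proof (rule analytic_continuation_open[of "U \<inter> (S \<inter> T)" "S \<inter> T" f h])
    show "connected (S \<inter> T)"
      using assms(2) T(2) by (simp add: convex_Int convex_connected)
    show "f holomorphic_on S \<inter> T" "h holomorphic_on S \<inter> T"
      using assms(5) T(5) by (auto intro: holomorphic_on_subset)
  qed (use assms T U in auto)
  then show "w = f z" using T(7) by simp
qed

definition hyp2F1 :: "complex \<Rightarrow> complex \<Rightarrow> complex \<Rightarrow> complex \<Rightarrow> complex" where
  "hyp2F1 a b c = segment_continuation (hypergeom [a, b] [c])"

definition rho :: "real \<Rightarrow> real \<Rightarrow> real" where
  "rho b \<iota> = b + \<iota>"

definition mu :: "real \<Rightarrow> real \<Rightarrow> real measure" where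
  "mu b \<iota> = density lborel
     (\<lambda>t. ennreal (2 powr (2 * b + \<iota>) * \<bar>sinh t\<bar> powr (2 * b) * \<bar>sinh (2 * t)\<bar> powr \<iota>))"

definition G_fun :: "real \<Rightarrow> real \<Rightarrow> complex \<Rightarrow> real \<Rightarrow> complex" where
  "G_fun b \<iota> \<nu> t =
     (let \<Phi> = hyp2F1 ((\<nu> + of_real (rho b \<iota>)) / 2) ((- \<nu> + of_real (rho b \<iota>)) / 2)
                 (of_real ((1 + \<iota>) / 2 + b));
          x = - (of_real (sinh t))\<^sup>2
      in \<Phi> x + 1 / (\<nu> + of_real (rho b \<iota>)) * of_real (sinh (2 * t)) * deriv \<Phi> x)"

(* The two components of the transform are cherednik_opdam b iota 1 and
   cherednik_opdam b iota (-1). *)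
definition cherednik_opdam ::
  "real \<Rightarrow> real \<Rightarrow> real \<Rightarrow> (real \<Rightarrow> complex) \<Rightarrow> complex \<Rightarrow> complex" where
  "cherednik_opdam b \<iota> \<epsilon> f \<nu> = (LINT t|mu b \<iota>. f t * G_fun b \<iota> \<nu> (\<epsilon> * t))"

lemma distr_mu_uminus: "distr (mu b \<iota>) (mu b \<iota>) uminus = mu b \<iota>"
proof -
  define D :: "real \<Rightarrow> ennreal" where
    "D = (\<lambda>t. ennreal (2 powr (2 * b + \<iota>) * \<bar>sinh t\<bar> powr (2 * b) * \<bar>sinh (2 * t)\<bar> powr \<iota>))"
  have [measurable]: "(sinh :: real \<Rightarrow> real) \<in> borel_measurable borel"
    by (intro borel_measurable_continuous_onI continuous_intros)
  have D: "D \<in> borel_measurable borel"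
    unfolding D_def by measurable
  have D_minus: "(\<lambda>t. D (- t)) = D"
    by (simp add: D_def)
  have mu_D: "mu b \<iota> = density lborel D"
    by (simp add: mu_def D_def)
  have "density (distr lborel borel uminus) D =
          distr (density lborel (\<lambda>t. D (- t))) borel (uminus :: real \<Rightarrow> real)"
    using D by (rule density_distr) simp
  then have "density lborel D = distr (density lborel D) borel uminus"
    by (simp only: D_minus lborel_distr_uminus)
  moreover have "distr (density lborel D) borel uminus = distr (density lborel D) (density lborel D) uminus"
    by (rule distr_cong) simp_all
  ultimately show ?thesis
    by (simp only: mu_D)
qed

lemma integral_mu_uminus:
  fixes h :: "real \<Rightarrow> complex"
  shows "(LINT t|mu b \<iota>. h (- t)) = (LINT t|mu b \<iota>. h t)"
proof -
  have meas: "uminus \<in> measurable (mu b \<iota>) (mu b \<iota>)"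
    by (simp add: mu_def)
  show ?thesis
  proof (cases "h \<in> borel_measurable (mu b \<iota>)")
    case True
    show ?thesis
      using integral_distr[OF meas True] by (simp only: distr_mu_uminus)
  next
    case False
    have "(\<lambda>t. h (- t)) \<notin> borel_measurable (mu b \<iota>)"
    proof
      assume "(\<lambda>t. h (- t)) \<in> borel_measurable (mu b \<iota>)"
      from measurable_compose[OF meas this] False show False by simp
    qed
    with False have "\<not> integrable (mu b \<iota>) h" "\<not> integrable (mu b \<iota>) (\<lambda>t. h (- t))"
      by (blast dest: borel_measurable_integrable)+
    then show ?thesis
      by (simp add: not_integrable_integral_eq)
  qed
qed

lemma cherednik_opdam_reflect:
  "cherednik_opdam b \<iota> (- \<epsilon>) f \<nu> = cherednik_opdam b \<iota> \<epsilon> (\<lambda>t. f (- t)) \<nu>"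
  using integral_mu_uminus[of b \<iota> "\<lambda>t. f t * G_fun b \<iota> \<nu> (- \<epsilon> * t)"]
  by (simp add: cherednik_opdam_def)

lemma cherednik_opdam_even:
  assumes "\<And>t. f (- t) = f t"
  shows "cherednik_opdam b \<iota> (-1) f = cherednik_opdam b \<iota> 1 f"
  using assms cherednik_opdam_reflect[of b \<iota> 1 f] by (simp add: fun_eq_iff)

lemma cherednik_opdam_odd:
  assumes "\<And>t. f (- t) = - f t"
  shows "cherednik_opdam b \<iota> (-1) f \<nu> = - cherednik_opdam b \<iota> 1 f \<nu>"
  using assms cherednik_opdam_reflect[of b \<iota> 1 f \<nu>] by (simp add: cherednik_opdam_def)

(* Only meaningful for even f, where both components agree by cherednik_opdam_even. *)
definition even_transform :: "real \<Rightarrow> real \<Rightarrow> (real \<Rightarrow> complex) \<Rightarrow> complex \<Rightarrow> complex" where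
  "even_transform b \<iota> f = cherednik_opdam b \<iota> 1 f"

definition w_fun :: "real \<Rightarrow> real \<Rightarrow> real" where
  "w_fun \<sigma> t = cosh t powr (- \<sigma>)"

definition sigma0 :: "real \<Rightarrow> real \<Rightarrow> real \<Rightarrow> real" where
  "sigma0 b \<iota> \<sigma> = \<sigma> - (\<iota> + b + 1)"

definition delta0 :: "real \<Rightarrow> real \<Rightarrow> real" where
  "delta0 b \<iota> = (\<iota> - 1) / 2 + b"

definition delta1 :: "real \<Rightarrow> real \<Rightarrow> real" where
  "delta1 b \<iota> = delta0 b \<iota> + 1"

(* For alpha, beta > -1 the conditions determine p: they fix it up to a scalar, and p(1) is
   nonzero. *)
definition jacobi_poly :: "nat \<Rightarrow> real \<Rightarrow> real \<Rightarrow> real poly" where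
  "jacobi_poly n \<alpha> \<beta> =
     (THE p. degree p = n \<and>
             poly p 1 = pochhammer (\<alpha> + 1) n / fact n \<and>
             (\<forall>q. degree q < n \<longrightarrow>
                (LBINT x:{-1<..<1}. poly p x * poly q x * ((1 - x) powr \<alpha> * (1 + x) powr \<beta>)) = 0))"

definition Q_plus :: "real \<Rightarrow> real \<Rightarrow> real \<Rightarrow> nat \<Rightarrow> real \<Rightarrow> real" where
  "Q_plus b \<iota> \<sigma> n t =
     w_fun \<sigma> t * poly (jacobi_poly n (sigma0 b \<iota> \<sigma>) (delta0 b \<iota>)) (2 * (tanh t)\<^sup>2 - 1)"

definition Q_minus :: "real \<Rightarrow> real \<Rightarrow> real \<Rightarrow> nat \<Rightarrow> real \<Rightarrow> real" where
  "Q_minus b \<iota> \<sigma> n t =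
     w_fun \<sigma> t * poly (jacobi_poly n (sigma0 b \<iota> \<sigma>) (delta1 b \<iota>)) (2 * (tanh t)\<^sup>2 - 1) * tanh t"

(* Q_minus is odd, so by cherednik_opdam_odd its two transforms are negatives of each other.
   A factor (epsilon * nu + rho) for the component epsilon = 1, -1 violates this; the factor
   compatible with the sign conventions of G_fun is epsilon * (nu - rho), which agrees with
   epsilon * nu + rho for epsilon = -1. *)

end

theory Submission
  imports Defs
begin

text \<open>
  The even part \<open>\<phi>\<close> of \<open>G\<close> is the Jacobi function, an eigenfunction
  \<open>L \<phi> = (\<nu>\<^sup>2 - \<rho>\<^sup>2) \<phi>\<close> of the radial operator
  \<open>L = d\<^sup>2/dt\<^sup>2 + ((2b + \<iota>) coth t + \<iota> tanh t) d/dt\<close>, which is symmetric with respect to \<open>\<mu>\<close>;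
  the odd part is \<open>- \<phi>' / (\<nu> + \<rho>)\<close>.
  Since \<open>L w\<^sub>\<sigma> = \<sigma> (\<sigma> - 2\<rho>) w\<^sub>\<sigma> - \<sigma> (\<sigma> + 1 - \<iota>) w\<^bsub>\<sigma>+2\<^esub>\<close>, integration by parts expresses the
  transform of \<open>w\<^bsub>\<sigma>+2\<^esub>\<close> as a rational multiple of that of \<open>w\<^sub>\<sigma>\<close>, and the transform of
  \<open>w\<^sub>\<sigma> tanh\<close>, a multiple of the derivative of \<open>w\<^sub>\<sigma>\<close>, as a multiple of that of \<open>w\<^sub>\<sigma>\<close>.
  As \<open>1 - tanh\<^sup>2 t = (cosh t)\<^sup>-\<^sup>2\<close>, expanding a Jacobi polynomial in powers of \<open>(1 - x) / 2\<close> turns a Jacobi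
  type function into a finite sum of the \<open>w\<^bsub>\<sigma>+2k\<^esub>\<close>, and the terms add up to the \<open>\<^sub>4F\<^sub>3\<close>.
  The boundary terms vanish because \<open>\<phi>\<close> and \<open>\<phi>'\<close> are bounded for imaginary \<open>\<nu>\<close>.
\<close>

section \<open>The hypergeometric function on a half-plane\<close>

text \<open>The left-hand side of Gauss's hypergeometric differential equation, as an operator on
  formal power series.\<close>

definition fps_hyp_ode :: "complex \<Rightarrow> complex \<Rightarrow> complex \<Rightarrow> complex fps \<Rightarrow> complex fps" where
  "fps_hyp_ode a b c P =
     fps_X * (1 - fps_X) * fps_deriv (fps_deriv P) +
     (fps_const c - fps_const (a + b + 1) * fps_X) * fps_deriv P - fps_const (a * b) * P"

text \<open>Comparing coefficients turns the differential equation into a two-term recurrence, from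
  which both solvability and uniqueness are read off.\<close>

lemma fps_hyp_ode_nth:
  "fps_nth (fps_hyp_ode a b c P) n =
     of_nat (Suc n) * (c + of_nat n) * fps_nth P (Suc n)
     - (a + of_nat n) * (b + of_nat n) * fps_nth P n"
proof -
  \<comment> \<open>Gathering everything divisible by \<open>fps_X\<close> under one outer factor
    makes the coefficient extraction a plain index shift.\<close>
  have eq: "fps_hyp_ode a b c P =
     fps_X * (fps_deriv (fps_deriv P) - fps_X * fps_deriv (fps_deriv P)
              - fps_const (a + b + 1) * fps_deriv P)
     + fps_const c * fps_deriv P - fps_const (a * b) * P"
    by (simp add: fps_hyp_ode_def algebra_simps)
  show ?thesis
  proof (cases n)
    case 0
    then show ?thesis by (simp add: eq)
  next
    case (Suc m)
    show ?thesis
      by (cases m) (simp_all add: eq Suc algebra_simps)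
  qed
qed

lemma fps_hypergeo_2F1_Suc:
  fixes a b c :: complex
  assumes "c \<notin> \<int>\<^sub>\<le>\<^sub>0"
  shows "of_nat (Suc n) * (c + of_nat n) * fps_nth (fps_hypergeo [a, b] [c] 1) (Suc n) =
           (a + of_nat n) * (b + of_nat n) * fps_nth (fps_hypergeo [a, b] [c] 1) n"
proof -
  have nz: "c + of_nat n \<noteq> 0"
    using assms plus_of_nat_eq_0_imp by metis
  have "fps_nth (fps_hypergeo [a, b] [c] 1) (Suc n) =
      ((a + of_nat n) * (b + of_nat n)) / (of_nat (Suc n) * (c + of_nat n)) * fps_nth (fps_hypergeo [a, b] [c] 1) n"
    unfolding fps_hypergeo_rec by (simp del: fps_hypergeo_nth of_nat_Suc)
  then show ?thesis
    using nz of_nat_neq_0[of n, where 'a = complex] by (simp del: fps_hypergeo_nth of_nat_Suc)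
qed

lemma fps_hyp_ode_hypergeo:
  assumes "c \<notin> \<int>\<^sub>\<le>\<^sub>0"
  shows "fps_hyp_ode a b c (fps_hypergeo [a, b] [c] 1) = 0"
  by (rule fps_ext) (simp only: fps_hyp_ode_nth fps_hypergeo_2F1_Suc[OF assms] fps_zero_nth diff_self)

text \<open>The factor in front of the next coefficient in the recurrence never vanishes when
  \<open>c\<close> is not a nonpositive integer, so the constant term determines the whole
  series.\<close>

lemma fps_hyp_ode_unique:
  assumes c: "c \<notin> \<int>\<^sub>\<le>\<^sub>0" and ode: "fps_hyp_ode a b c P = 0" and P0: "fps_nth P 0 = 1"
  shows "P = fps_hypergeo [a, b] [c] 1"
proof (rule fps_ext)
  fix n
  show "fps_nth P n = fps_nth (fps_hypergeo [a, b] [c] 1) n"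
  proof (induction n)
    case 0
    then show ?case by (simp add: P0)
  next
    case (Suc n)
    have nz: "of_nat (Suc n) * (c + of_nat n) \<noteq> 0"
      using c plus_of_nat_eq_0_imp by (metis mult_eq_0_iff of_nat_neq_0)
    have "fps_nth (fps_hyp_ode a b c P) n = fps_nth (fps_hyp_ode a b c (fps_hypergeo [a, b] [c] 1)) n"
      using ode fps_hyp_ode_hypergeo[OF c] by simp
    then have "of_nat (Suc n) * (c + of_nat n) * fps_nth P (Suc n) =
        of_nat (Suc n) * (c + of_nat n) * fps_nth (fps_hypergeo [a, b] [c] 1) (Suc n)"
      by (simp add: fps_hyp_ode_nth Suc.IH del: fps_hypergeo_nth of_nat_Suc)
    with nz show ?case by (metis mult_left_cancel)
  qed
qed

lemma has_fps_expansion_hyp_ode: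
  assumes "f has_fps_expansion P"
  shows "(\<lambda>z. z * (1 - z) * deriv (deriv f) z + (c - (a + b + 1) * z) * deriv f z - a * b * f z)
           has_fps_expansion fps_hyp_ode a b c P"
  unfolding fps_hyp_ode_def by (intro fps_expansion_intros assms)

section \<open>Convergence and the differential equation on the unit disc\<close>

text \<open>The conditions on \<open>a\<close> and \<open>b\<close> keep the series from
  terminating; all coefficients are then nonzero and their successive ratios tend to 1.\<close>

lemma fps_conv_radius_hypergeo_2F1:
  assumes "a \<notin> \<int>\<^sub>\<le>\<^sub>0" "b \<notin> \<int>\<^sub>\<le>\<^sub>0" "c \<notin> \<int>\<^sub>\<le>\<^sub>0"
  shows "fps_conv_radius (fps_hypergeo [a, b] [c] (1::complex)) = 1"
proof -
  define P where "P = fps_hypergeo [a, b] [c] (1::complex)"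
  have nz: "x + of_nat n \<noteq> 0" if "x \<notin> \<int>\<^sub>\<le>\<^sub>0" for x :: complex and n
    using that plus_of_nat_eq_0_imp by metis
  have Pnz: "fps_nth P n \<noteq> 0" for n
    using assms by (auto simp: P_def pochhammer_eq_0_iff)
  have lim: "(\<lambda>n. (x + of_nat n) / (y + of_nat n)) \<longlonglongrightarrow> 1" if "y \<notin> \<int>\<^sub>\<le>\<^sub>0" for x y :: complex
  proof -
    have "filterlim (\<lambda>n. y + of_nat n) at_infinity sequentially"
      by (intro tendsto_add_filterlim_at_infinity[OF tendsto_const] tendsto_of_nat)
    then have "(\<lambda>n. 1 + (x - y) / (y + of_nat n)) \<longlonglongrightarrow> 1 + 0"
      by (intro tendsto_add tendsto_divide_0[OF tendsto_const] tendsto_const)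
    then show ?thesis
      using nz[OF that] by (simp add: divide_simps add_ac)
  qed
  have ratio: "fps_nth P n / fps_nth P (Suc n) =
      ((c + of_nat n) / (a + of_nat n)) * ((1 + of_nat n) / (b + of_nat n))" for n
  proof -
    have "of_nat (Suc n) * (c + of_nat n) * fps_nth P (Suc n) = (a + of_nat n) * (b + of_nat n) * fps_nth P n"
      using fps_hypergeo_2F1_Suc[OF assms(3)] by (simp add: P_def)
    then show ?thesis
      using Pnz[of "Suc n"] nz[OF assms(1), of n] nz[OF assms(2), of n] by (simp add: divide_simps mult_ac)
  qed
  have "(\<lambda>n. norm (fps_nth P n / fps_nth P (Suc n))) \<longlonglongrightarrow> norm (1 * 1 :: complex)"
    unfolding ratio using assms by (intro tendsto_norm tendsto_mult lim)
  then show ?thesis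
    unfolding fps_conv_radius_def P_def
    by (intro conv_radius_ratio_limit_nonzero[of _ 1]) (auto simp: norm_divide one_ereal_def simp del: fps_hypergeo_nth)
qed

text \<open>The formal identity gives the equation near 0 only; the identity theorem spreads it over
  the disc.\<close>

lemma hypergeom_has_ode:
  assumes abc: "a \<notin> \<int>\<^sub>\<le>\<^sub>0" "b \<notin> \<int>\<^sub>\<le>\<^sub>0" "c \<notin> \<int>\<^sub>\<le>\<^sub>0" and z: "norm z < 1"
  defines "F \<equiv> hypergeom [a, b] [c]"
  shows "z * (1 - z) * deriv (deriv F) z + (c - (a + b + 1) * z) * deriv F z - a * b * F z = 0"
proof -
  have F: "F = eval_fps (fps_hypergeo [a, b] [c] 1)"
    by (simp add: F_def hypergeom_def fun_eq_iff)
  have hol: "F holomorphic_on ball 0 1"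
    unfolding F using fps_conv_radius_hypergeo_2F1[OF abc]
    by (intro holomorphic_on_eval_fps) (auto simp: one_ereal_def)
  have "F has_fps_expansion fps_hypergeo [a, b] [c] 1"
    unfolding F using fps_conv_radius_hypergeo_2F1[OF abc]
    by (intro eval_fps_has_fps_expansion) auto
  from has_fps_expansion_hyp_ode[OF this, of c a b] fps_hyp_ode_hypergeo[OF abc(3)]
  have "(\<lambda>z. z * (1 - z) * deriv (deriv F) z + (c - (a + b + 1) * z) * deriv F z - a * b * F z)
          has_fps_expansion 0"
    by simp
  then have "eventually (\<lambda>z. z * (1 - z) * deriv (deriv F) z + (c - (a + b + 1) * z) * deriv F z
               - a * b * F z = 0) (nhds 0)"
    by (auto simp: has_fps_expansion_def elim: eventually_mono)
  then obtain U where U: "open U" "0 \<in> U" "\<And>z. z \<in> U \<Longrightarrow>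
      z * (1 - z) * deriv (deriv F) z + (c - (a + b + 1) * z) * deriv F z - a * b * F z = 0"
    by (auto simp: eventually_nhds)
  define L where
    "L = (\<lambda>z. z * (1 - z) * deriv (deriv F) z + (c - (a + b + 1) * z) * deriv F z - a * b * F z)"
  have "L z = 0"
  proof (rule analytic_continuation_open[of "U \<inter> ball 0 1" "ball 0 1" L "\<lambda>_. 0"])
    show "L holomorphic_on ball 0 1"
      unfolding L_def by (intro holomorphic_intros hol holomorphic_deriv) auto
  qed (use U z in \<open>auto simp: L_def\<close>)
  then show ?thesis by (simp add: L_def)
qed

text \<open>
  Pfaff's transformation continues the hypergeometric function from the unit disc to the half-plane
  \<open>Re z < 1/2\<close>, which is convex and contains the negative real axis.
\<close>

definition pfaff_2F1 :: "complex \<Rightarrow> complex \<Rightarrow> complex \<Rightarrow> complex \<Rightarrow> complex" where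
  "pfaff_2F1 a b c z = (1 - z) powr (- a) * hypergeom [a, c - b] [c] (z / (z - 1))"

text \<open>The half-plane consists of the points closer to 0 than to 1.\<close>

lemma norm_pfaff_arg:
  assumes "Re z < 1/2"
  shows "norm (z / (z - 1)) < 1"
proof -
  have "norm z ^ 2 < norm (z - 1) ^ 2"
    using assms by (simp add: cmod_power2) (simp add: power2_eq_square algebra_simps)
  then have "norm z < norm (z - 1)"
    using power_less_imp_less_base by fastforce
  then show ?thesis
    by (simp add: norm_divide divide_simps)
qed

text \<open>Conditions are put on \<open>a\<close>, \<open>c - b\<close> and \<open>c\<close>
  because these are the parameters of the series inside Pfaff's formula.\<close>

context
  fixes a b c :: complex
  assumes abc: "a \<notin> \<int>\<^sub>\<le>\<^sub>0" "c - b \<notin> \<int>\<^sub>\<le>\<^sub>0" "c \<notin> \<int>\<^sub>\<le>\<^sub>0"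
begin

private definition "H = hypergeom [a, c - b] [c]"

private lemma hol_H: "H holomorphic_on ball 0 1"
proof -
  have "H = eval_fps (fps_hypergeo [a, c - b] [c] 1)"
    by (simp add: H_def hypergeom_def fun_eq_iff)
  then show ?thesis
    using fps_conv_radius_hypergeo_2F1[OF abc]
    by (auto simp: one_ereal_def intro!: holomorphic_on_eval_fps)
qed

private lemma DERIV_H:
  assumes "Re z < 1/2"
  shows "((\<lambda>z. H (z / (z - 1))) has_field_derivative
            - deriv H (z / (z - 1)) / (1 - z)^2) (at z)"
    and "((\<lambda>z. deriv H (z / (z - 1))) has_field_derivative
            - deriv (deriv H) (z / (z - 1)) / (1 - z)^2) (at z)"
proof -
  have nz: "z \<noteq> 1" "1 - z \<noteq> 0" using assms by auto
  have w: "z / (z - 1) \<in> ball 0 1"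
    using norm_pfaff_arg[OF assms] by simp
  have dw: "((\<lambda>z. z / (z - 1)) has_field_derivative - (1 / (1 - z)^2)) (at z)"
    using nz by (auto intro!: derivative_eq_intros simp: divide_simps) (simp add: algebra_simps power2_eq_square)
  show "((\<lambda>z. H (z / (z - 1))) has_field_derivative
            - deriv H (z / (z - 1)) / (1 - z)^2) (at z)"
    using DERIV_chain2[OF holomorphic_derivI[OF hol_H open_ball w] dw] by simp
  show "((\<lambda>z. deriv H (z / (z - 1))) has_field_derivative
            - deriv (deriv H) (z / (z - 1)) / (1 - z)^2) (at z)"
    using DERIV_chain2[OF holomorphic_derivI[OF holomorphic_deriv[OF hol_H open_ball] open_ball w] dw]
    by simp
qed

private lemma DERIV_one_minus_powr:
  assumes "Re z < 1/2"
  shows "((\<lambda>z. (1 - z) powr (- a)) has_field_derivative a * (1 - z) powr (- a) / (1 - z)) (at z)"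
proof -
  have *: "1 - z \<notin> \<real>\<^sub>\<le>\<^sub>0" using assms by (auto simp: complex_nonpos_Reals_iff)
  then have nz: "1 - z \<noteq> 0" by auto
  have "((\<lambda>z. (1 - z) powr (- a)) has_field_derivative a * (1 - z) powr (- a - 1)) (at z)"
    by (rule derivative_eq_intros refl * | simp)+
  then show ?thesis using nz by (simp add: powr_diff)
qed

private lemma DERIV_pfaff:
  assumes "Re z < 1/2"
  shows "(pfaff_2F1 a b c has_field_derivative
           (1 - z) powr (- a) * (a / (1 - z) * H (z / (z - 1)) - deriv H (z / (z - 1)) / (1 - z)^2)) (at z)"
proof -
  have nz: "1 - z \<noteq> 0" using assms by auto
  have eq: "pfaff_2F1 a b c = (\<lambda>z. (1 - z) powr (- a) * H (z / (z - 1)))"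
    by (simp add: pfaff_2F1_def H_def fun_eq_iff)
  show ?thesis
    unfolding eq
    by (rule DERIV_cong[OF DERIV_mult[OF DERIV_one_minus_powr[OF assms] DERIV_H(1)[OF assms]]])
       (simp add: algebra_simps)
qed

private lemma deriv_pfaff:
  assumes "Re z < 1/2"
  shows "deriv (pfaff_2F1 a b c) z =
           (1 - z) powr (- a) * (a / (1 - z) * H (z / (z - 1)) - deriv H (z / (z - 1)) / (1 - z)^2)"
  using DERIV_pfaff[OF assms] by (rule DERIV_imp_deriv)

private lemma deriv2_pfaff:
  assumes z: "Re z < 1/2"
  shows "deriv (deriv (pfaff_2F1 a b c)) z =
           (1 - z) powr (- a) * (a * (a + 1) / (1 - z)^2 * H (z / (z - 1))
             - (2 * a + 2) / (1 - z)^3 * deriv H (z / (z - 1))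
             + deriv (deriv H) (z / (z - 1)) / (1 - z)^4)"
proof -
  have nz: "1 - z \<noteq> 0" using z by auto
  have ev: "eventually (\<lambda>z. deriv (pfaff_2F1 a b c) z =
           (1 - z) powr (- a) * (a / (1 - z) * H (z / (z - 1)) - deriv H (z / (z - 1)) / (1 - z)^2)) (nhds z)"
    using eventually_nhds_in_open[of "{z. Re z < 1/2}" z] open_halfspace_Re_lt[of "1/2"] z
    by (auto elim!: eventually_mono simp: deriv_pfaff)
  have "((\<lambda>z. (1 - z) powr (- a) * (a / (1 - z) * H (z / (z - 1)) - deriv H (z / (z - 1)) / (1 - z)^2))
          has_field_derivative
           (1 - z) powr (- a) * (a * (a + 1) / (1 - z)^2 * H (z / (z - 1))
             - (2 * a + 2) / (1 - z)^3 * deriv H (z / (z - 1))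
             + deriv (deriv H) (z / (z - 1)) / (1 - z)^4)) (at z)"
  proof (rule DERIV_cong[OF DERIV_mult[OF DERIV_one_minus_powr[OF z]]])
    show "((\<lambda>z. a / (1 - z) * H (z / (z - 1)) - deriv H (z / (z - 1)) / (1 - z)^2) has_field_derivative
            (a / (1 - z)^2 * H (z / (z - 1)) - a / (1 - z)^3 * deriv H (z / (z - 1)))
            - (- deriv (deriv H) (z / (z - 1)) / (1 - z)^4 + 2 * deriv H (z / (z - 1)) / (1 - z)^3)) (at z)"
      using nz
      apply (auto intro!: derivative_eq_intros DERIV_H[OF z])
      apply (simp add: divide_simps)
      apply algebra
      done
  next
    \<comment> \<open>With \<open>r\<close> standing for \<open>1 / (1 - z)\<close> the claim is a
      polynomial identity, free of divisions.\<close>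
    have alg: "a * u * r * (a * r * h - h1 * r^2) + ((a * r^2 * h - a * r^3 * h1) - (- h2 * r^4 + 2 * h1 * r^3)) * u
       = u * (a * (a + 1) * r^2 * h - (2 * a + 2) * r^3 * h1 + h2 * r^4)" for u r h h1 h2 :: complex
      by algebra
    show "a * (1 - z) powr (- a) / (1 - z) * (a / (1 - z) * H (z / (z - 1)) - deriv H (z / (z - 1)) / (1 - z)^2) +
        ((a / (1 - z)^2 * H (z / (z - 1)) - a / (1 - z)^3 * deriv H (z / (z - 1)))
          - (- deriv (deriv H) (z / (z - 1)) / (1 - z)^4 + 2 * deriv H (z / (z - 1)) / (1 - z)^3)) * (1 - z) powr (- a)
       = (1 - z) powr (- a) * (a * (a + 1) / (1 - z)^2 * H (z / (z - 1))
             - (2 * a + 2) / (1 - z)^3 * deriv H (z / (z - 1))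
             + deriv (deriv H) (z / (z - 1)) / (1 - z)^4)"
      using alg[of "(1 - z) powr (- a)" "inverse (1 - z)" "H (z / (z - 1))" "deriv H (z / (z - 1))" "deriv (deriv H) (z / (z - 1))"]
      by (simp only: divide_inverse power_inverse mult_minus_left)
  qed
  from DERIV_imp_deriv[OF this] show ?thesis
    by (subst deriv_cong_ev[OF ev refl])
qed

text \<open>The substitution \<open>w = z / (z - 1)\<close> together with the prefactor
  \<open>(1 - z) powr (- a)\<close> carries the equation with parameters \<open>a\<close>,
  \<open>c - b\<close>, \<open>c\<close> into the one with \<open>a\<close>, \<open>b\<close>,
  \<open>c\<close>.\<close>

lemma pfaff_ode:
  assumes z: "Re z < 1/2"
  defines "g \<equiv> pfaff_2F1 a b c"
  shows "z * (1 - z) * deriv (deriv g) z + (c - (a + b + 1) * z) * deriv g z - a * b * g z = 0"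
proof -
  define w where "w = z / (z - 1)"
  have nz: "1 - z \<noteq> 0" "z - 1 \<noteq> 0" using z by auto
  have "w * (1 - w) * deriv (deriv H) w + (c - (a + (c - b) + 1) * w) * deriv H w - a * (c - b) * H w = 0"
    using hypergeom_has_ode[OF abc, of w] norm_pfaff_arg[OF z] by (simp add: w_def H_def)
  moreover have "w = - z / (1 - z)" "1 - w = 1 / (1 - z)"
    using nz by (simp_all add: w_def divide_simps) (simp_all add: algebra_simps)
  ultimately have ode: "- z / (1 - z)^2 * deriv (deriv H) w
      + (c + (a + (c - b) + 1) * z / (1 - z)) * deriv H w - a * (c - b) * H w = 0"
    by (simp add: power2_eq_square)
  \<comment> \<open>The new left-hand side is the old one at \<open>w\<close>, times
    \<open>- u / (1 - z)\<close>; here \<open>h\<close>, \<open>h1\<close>, \<open>h2\<close> stand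
    for \<open>H\<close> and its first two derivatives at \<open>w\<close>.\<close>
  have alg: "z * (1 - z) * (u * (a * (a + 1) / (1 - z)^2 * h - (2 * a + 2) / (1 - z)^3 * h1 + h2 / (1 - z)^4))
     + (c - (a + b + 1) * z) * (u * (a / (1 - z) * h - h1 / (1 - z)^2)) - a * b * (u * h) =
     - (u / (1 - z) * (- z / (1 - z)^2 * h2
      + (c + (a + (c - b) + 1) * z / (1 - z)) * h1 - a * (c - b) * h))" for u h h1 h2
    using nz by (simp add: divide_simps) algebra
  have "g z = (1 - z) powr (- a) * H w"
    by (simp add: g_def pfaff_2F1_def H_def w_def)
  then have "z * (1 - z) * deriv (deriv g) z + (c - (a + b + 1) * z) * deriv g z - a * b * g z =
     - ((1 - z) powr (- a) / (1 - z) * (- z / (1 - z)^2 * deriv (deriv H) w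
      + (c + (a + (c - b) + 1) * z / (1 - z)) * deriv H w - a * (c - b) * H w))"
    unfolding g_def deriv2_pfaff[OF z] deriv_pfaff[OF z] w_def[symmetric]
    by (simp only: alg)
  then show ?thesis using ode by simp
qed

lemma pfaff_holomorphic: "pfaff_2F1 a b c holomorphic_on {z. Re z < 1/2}"
  unfolding holomorphic_on_open[OF open_halfspace_Re_lt] using DERIV_pfaff by blast

text \<open>Pfaff's transformation near 0: the Taylor series of the right-hand side solves the
  formal equation and has constant term 1, so uniqueness identifies it with Gauss's series. No
  rearrangement of double series occurs.\<close>

lemma pfaff_has_fps_expansion:
  "pfaff_2F1 a b c has_fps_expansion fps_hypergeo [a, b] [c] 1"
proof -
  define g where "g = pfaff_2F1 a b c"
  define P where "P = fps_expansion g 0"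
  have "g analytic_on {0}"
    unfolding g_def by (rule holomorphic_on_imp_analytic_at[OF pfaff_holomorphic open_halfspace_Re_lt]) simp
  then have P: "g has_fps_expansion P"
    unfolding P_def by (rule analytic_at_imp_has_fps_expansion_0)
  have "eventually (\<lambda>z. z * (1 - z) * deriv (deriv g) z + (c - (a + b + 1) * z) * deriv g z - a * b * g z = 0)
          (nhds 0)"
    unfolding g_def by (rule eventually_mono[OF eventually_nhds_in_open[OF open_halfspace_Re_lt[of "1/2"]]])
      (use pfaff_ode in auto)
  then have "(\<lambda>z. z * (1 - z) * deriv (deriv g) z + (c - (a + b + 1) * z) * deriv g z - a * b * g z)
          has_fps_expansion 0 \<longleftrightarrow> (\<lambda>_::complex. 0::complex) has_fps_expansion 0"
    by (intro has_fps_expansion_cong) auto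
  then have "fps_hyp_ode a b c P = 0"
    using fps_expansion_unique_complex[OF has_fps_expansion_hyp_ode[OF P, of c a b]] by simp
  moreover have "fps_nth P 0 = 1"
    using has_fps_expansion_imp_0_eq_fps_nth_0[OF P]
    by (simp add: g_def pfaff_2F1_def hypergeom_def eval_fps_at_0)
  ultimately have "P = fps_hypergeo [a, b] [c] 1"
    using fps_hyp_ode_unique abc(3) by blast
  then show ?thesis using P g_def by simp
qed

text \<open>A single convex open set, the half-plane, witnesses the continuation for all its points
  at once, so Pfaff's formula is its value throughout.\<close>

theorem hyp2F1_eq_pfaff:
  assumes "Re z < 1/2"
  shows "hyp2F1 a b c z = pfaff_2F1 a b c z"
  unfolding hyp2F1_def
proof (rule segment_continuation_eqI)
  show "open {z. Re z < 1/2}" "convex {z. Re z < 1/2}"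
    by (rule open_halfspace_Re_lt convex_halfspace_Re_lt)+
  show "pfaff_2F1 a b c holomorphic_on {z. Re z < 1/2}" by (rule pfaff_holomorphic)
  show "\<forall>\<^sub>F u in nhds 0. pfaff_2F1 a b c u = hypergeom [a, b] [c] u"
    using pfaff_has_fps_expansion unfolding has_fps_expansion_def hypergeom_def
    by (auto elim!: eventually_mono)
qed (use assms in auto)

lemma hyp2F1_holomorphic: "hyp2F1 a b c holomorphic_on {z. Re z < 1/2}"
  by (rule holomorphic_transform[OF pfaff_holomorphic]) (simp add: hyp2F1_eq_pfaff)

text \<open>Agreement with Pfaff's function on an open set extends to both derivatives.\<close>

lemma hyp2F1_ode:
  assumes z: "Re z < 1/2"
  defines "g \<equiv> hyp2F1 a b c"
  shows "z * (1 - z) * deriv (deriv g) z + (c - (a + b + 1) * z) * deriv g z - a * b * g z = 0"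
proof -
  have ev: "eventually (\<lambda>z. g z = pfaff_2F1 a b c z) (nhds w)" if "Re w < 1/2" for w
    using eventually_nhds_in_open[of "{z. Re z < 1/2}" w] open_halfspace_Re_lt[of "1/2"] that
    by (auto elim!: eventually_mono simp: g_def hyp2F1_eq_pfaff)
  have d: "deriv g w = deriv (pfaff_2F1 a b c) w" if "Re w < 1/2" for w
    using deriv_cong_ev[OF ev[OF that] refl] .
  have "eventually (\<lambda>w. deriv g w = deriv (pfaff_2F1 a b c) w) (nhds z)"
    using eventually_nhds_in_open[of "{z. Re z < 1/2}" z] open_halfspace_Re_lt[of "1/2"] z
    by (auto elim!: eventually_mono simp: d)
  then have d2: "deriv (deriv g) z = deriv (deriv (pfaff_2F1 a b c)) z"
    by (rule deriv_cong_ev) simp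
  show ?thesis
    using pfaff_ode[OF z] by (simp only: d2 d[OF z]) (simp add: g_def hyp2F1_eq_pfaff[OF z])
qed

end

section \<open>Jacobi polynomials\<close>

text \<open>Coefficients with respect to powers of \<open>(1 - x) / 2\<close>, taken from the
  representation of the Jacobi polynomial as a multiple of a terminating 2F1 with parameters
  \<open>- n\<close>, \<open>n + \<alpha> + \<beta> + 1\<close> and
  \<open>\<alpha> + 1\<close>.\<close>

definition jacobi_coeff :: "nat \<Rightarrow> real \<Rightarrow> real \<Rightarrow> nat \<Rightarrow> real" where
  "jacobi_coeff n \<alpha> \<beta> k = pochhammer (\<alpha> + 1) n / fact n *
     (pochhammer (- of_nat n) k * pochhammer (of_nat n + \<alpha> + \<beta> + 1) k / (pochhammer (\<alpha> + 1) k * fact k))"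

definition jacobi_explicit :: "nat \<Rightarrow> real \<Rightarrow> real \<Rightarrow> real poly" where
  "jacobi_explicit n \<alpha> \<beta> = (\<Sum>k\<le>n. smult (jacobi_coeff n \<alpha> \<beta> k) ([:1/2, -1/2:] ^ k))"

definition jacobi_weight :: "real \<Rightarrow> real \<Rightarrow> real \<Rightarrow> real" where
  "jacobi_weight \<alpha> \<beta> x = (1 - x) powr \<alpha> * (1 + x) powr \<beta>"

lemma poly_jacobi_explicit:
  "poly (jacobi_explicit n \<alpha> \<beta>) x = (\<Sum>k\<le>n. jacobi_coeff n \<alpha> \<beta> k * ((1 - x) / 2) ^ k)"
  by (simp add: jacobi_explicit_def poly_sum diff_divide_distrib)

lemma poly_jacobi_explicit_1:
  "poly (jacobi_explicit n \<alpha> \<beta>) 1 = pochhammer (\<alpha> + 1) n / fact n"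
proof -
  have "poly (jacobi_explicit n \<alpha> \<beta>) 1 = (\<Sum>k\<le>n. if k = 0 then jacobi_coeff n \<alpha> \<beta> 0 else 0)"
    unfolding poly_jacobi_explicit by (intro sum.cong) auto
  then show ?thesis by (simp add: jacobi_coeff_def)
qed

text \<open>The top coefficient is nonzero: \<open>pochhammer (- of_nat n) n\<close> is
  \<open>n!\<close> up to sign, and the other two Pochhammer symbols have positive base. For
  \<open>n + \<alpha> + \<beta> + 1\<close> positivity relies on \<open>n \<ge> 1\<close>, hence the
  case distinction.\<close>

lemma degree_jacobi_explicit:
  assumes "\<alpha> > -1" "\<beta> > -1"
  shows "degree (jacobi_explicit n \<alpha> \<beta>) = n"
proof (cases "n = 0")
  case True
  then show ?thesis by (simp add: jacobi_explicit_def)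
next
  case False
  define m where "m = n - 1"
  have n: "n = Suc m" using False by (simp add: m_def)
  have deg: "degree (smult c ([:1/2, -1/2:] ^ k) :: real poly) \<le> k" for c k
    using degree_power_le[of "[:1/2, -1/2:] :: real poly" k] degree_smult_le[of c "[:1/2, -1/2:] ^ k"] by simp
  have "of_nat n + \<alpha> + \<beta> + 1 > 0" using assms n by simp
  then have "pochhammer (of_nat n + \<alpha> + \<beta> + 1) n > 0" by (rule pochhammer_pos)
  moreover have "pochhammer (\<alpha> + 1) n > 0" using assms by (intro pochhammer_pos) simp
  ultimately have nz: "jacobi_coeff n \<alpha> \<beta> n \<noteq> 0"
    by (auto simp: jacobi_coeff_def pochhammer_same)
  have eq: "jacobi_explicit n \<alpha> \<beta> =
      (\<Sum>k\<le>m. smult (jacobi_coeff n \<alpha> \<beta> k) ([:1/2, -1/2:] ^ k))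
      + smult (jacobi_coeff n \<alpha> \<beta> n) ([:1/2, -1/2:] ^ n)"
    by (simp add: jacobi_explicit_def n)
  have "degree (\<Sum>k\<le>m. smult (jacobi_coeff n \<alpha> \<beta> k) ([:1/2, -1/2:] ^ k) :: real poly) \<le> m"
    by (intro degree_sum_le order_trans[OF deg]) auto
  moreover have "degree (smult (jacobi_coeff n \<alpha> \<beta> n) ([:1/2, -1/2:] ^ n) :: real poly) = n"
    using nz by (simp add: degree_power_eq)
  ultimately show ?thesis
    unfolding eq using n by (subst degree_add_eq_right) auto
qed

section \<open>Moments of the Jacobi weight and orthogonality\<close>

text \<open>Euler's Beta integral over the unit interval, moved to \<open>(-1, 1)\<close> by
  \<open>t = (1 + x) / 2\<close>.\<close>

lemma has_bochner_integral_jacobi_weight: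
  fixes \<alpha> \<beta> :: real
  assumes "\<alpha> > -1" "\<beta> > -1"
  shows "has_bochner_integral lborel
           (\<lambda>x. indicator {-1<..<1} x *\<^sub>R (((1 - x) / 2) ^ k * ((1 + x) / 2) ^ j * jacobi_weight \<alpha> \<beta> x))
           (2 powr (\<alpha> + \<beta> + 1) * Beta (\<beta> + 1 + of_nat j) (\<alpha> + 1 + of_nat k))"
proof -
  define p q where "p = \<beta> + of_nat j" and "q = \<alpha> + of_nat k"
  have pq: "p + 1 > 0" "q + 1 > 0" using assms by (auto simp: p_def q_def)
  define f :: "real \<Rightarrow> real" where "f = (\<lambda>t. indicator {0<..<1} t * (t powr p * (1 - t) powr q))"
  have HK: "((\<lambda>t. t powr p * (1 - t) powr q) has_integral Beta (p + 1) (q + 1)) {0<..<1}"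
    using has_integral_Beta_real[OF pq] by (simp add: has_integral_Icc_iff_Ioo)
  have int: "set_integrable lborel {0<..<1} (\<lambda>t. t powr p * (1 - t) powr q)"
  proof (rule set_integrable_subset)
    show "set_integrable lborel {0..1} (\<lambda>t. t powr p * (1 - t) powr q)"
      using integrable_Beta[OF pq] by simp
  qed auto
  then have "(LBINT t:{0<..<1}. t powr p * (1 - t) powr q) = Beta (p + 1) (q + 1)"
    using set_borel_integral_eq_integral(2)[OF int] HK by (simp add: integral_unique)
  with int have "has_bochner_integral lborel f (Beta (p + 1) (q + 1))"
    by (simp add: f_def has_bochner_integral_iff set_integrable_def set_lebesgue_integral_def)
  then have "has_bochner_integral lborel (\<lambda>x. f (1/2 + (1/2) * x)) (Beta (p + 1) (q + 1) /\<^sub>R \<bar>1/2\<bar>)"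
    by (subst (asm) lborel_has_bochner_integral_real_affine_iff[of "1/2" _ _ "1/2"]) auto
  \<comment> \<open>The extra constant compensates for the halves: the weight is built from
    \<open>1 - x\<close> and \<open>1 + x\<close>, whereas \<open>f\<close> sees
    \<open>(1 - x) / 2\<close> and \<open>(1 + x) / 2\<close>.\<close>
  then have "has_bochner_integral lborel (\<lambda>x. 2 powr (\<alpha> + \<beta>) * f (1/2 + (1/2) * x))
               (2 powr (\<alpha> + \<beta>) * (Beta (p + 1) (q + 1) /\<^sub>R \<bar>1/2\<bar>))"
    by (rule has_bochner_integral_mult_right)
  also have "(\<lambda>x. 2 powr (\<alpha> + \<beta>) * f (1/2 + (1/2) * x)) =
      (\<lambda>x. indicator {-1<..<1} x *\<^sub>R (((1 - x) / 2) ^ k * ((1 + x) / 2) ^ j * jacobi_weight \<alpha> \<beta> x))"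
  proof
    fix x :: real
    show "2 powr (\<alpha> + \<beta>) * f (1/2 + (1/2) * x) =
      indicator {-1<..<1} x *\<^sub>R (((1 - x) / 2) ^ k * ((1 + x) / 2) ^ j * jacobi_weight \<alpha> \<beta> x)"
    proof (cases "x \<in> {-1<..<1}")
      case True
      then have x: "1 + x > 0" "1 - x > 0" by auto
      have e1: "1/2 + (1/2) * x = (1 + x) / 2" and e2: "1 - (1 + x) / 2 = (1 - x) / 2"
        by (simp_all add: field_simps)
      have "f (1/2 + (1/2) * x) = ((1 + x) / 2) powr p * ((1 - x) / 2) powr q"
        unfolding f_def e1 e2 using x by (simp add: indicator_def)
      moreover have "((1 + x) / 2) powr p = ((1 + x) / 2) ^ j * ((1 + x) powr \<beta> / 2 powr \<beta>)"
        using x by (simp add: p_def powr_add powr_realpow powr_divide power_divide mult_ac)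
      moreover have "((1 - x) / 2) powr q = ((1 - x) / 2) ^ k * ((1 - x) powr \<alpha> / 2 powr \<alpha>)"
        using x by (simp add: q_def powr_add powr_realpow powr_divide power_divide mult_ac)
      ultimately show ?thesis
        using True by (simp add: jacobi_weight_def powr_add)
    next
      case False
      then have "1/2 + (1/2) * x \<notin> {0<..<1}" by auto
      with False show ?thesis by (simp add: f_def)
    qed
  qed
  finally show ?thesis
    by (simp add: p_def q_def powr_add add_ac mult_ac)
qed

lemma jacobi_weight_integrable:
  assumes "\<alpha> > -1" "\<beta> > -1"
  shows "set_integrable lborel {-1<..<1} (\<lambda>x. poly p x * jacobi_weight \<alpha> \<beta> x)"
proof -
  have W: "set_integrable lborel {-1<..<1} (jacobi_weight \<alpha> \<beta>)"
    using has_bochner_integral_jacobi_weight[OF assms, of 0 0]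
    by (simp add: has_bochner_integral_iff set_integrable_def)
  have "bounded (poly p ` {-1..1})"
    by (intro compact_imp_bounded compact_continuous_image continuous_intros) auto
  then obtain B where B: "\<And>x. x \<in> {-1..1} \<Longrightarrow> \<bar>poly p x\<bar> \<le> B"
    unfolding bounded_iff by fastforce
  have WB: "set_integrable lborel {-1<..<1} (\<lambda>x. B * jacobi_weight \<alpha> \<beta> x)"
    using W by simp
  have [measurable]: "poly p \<in> borel_measurable borel"
    by (intro borel_measurable_continuous_onI continuous_intros)
  have [measurable]: "jacobi_weight \<alpha> \<beta> \<in> borel_measurable borel"
    unfolding jacobi_weight_def by measurable
  show ?thesis
  proof (rule set_integrable_bound[OF WB])
    show "set_borel_measurable lborel {-1<..<1} (\<lambda>x. poly p x * jacobi_weight \<alpha> \<beta> x)"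
      unfolding set_borel_measurable_def by measurable
    show "AE x in lborel. x \<in> {-1<..<1} \<longrightarrow>
        norm (poly p x * jacobi_weight \<alpha> \<beta> x) \<le> norm (B * jacobi_weight \<alpha> \<beta> x)"
    proof (intro AE_I2 impI)
      fix x :: real assume "x \<in> {-1<..<1}"
      then have "\<bar>poly p x\<bar> \<le> B" using B by auto
      then have "\<bar>poly p x\<bar> \<le> \<bar>B\<bar>" by simp
      then show "norm (poly p x * jacobi_weight \<alpha> \<beta> x) \<le> norm (B * jacobi_weight \<alpha> \<beta> x)"
        by (simp add: abs_mult mult_right_mono)
    qed
  qed
qed

text \<open>Converts the Beta values in the moments into Pochhammer quotients, the form in which
  Chu--Vandermonde applies.\<close>

lemma Beta_plus_nat_right:
  fixes x y :: real
  assumes "x > 0" "y > 0"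
  shows "Beta x (y + of_nat k) = Beta x y * (pochhammer y k / pochhammer (x + y) k)"
proof -
  have *: "Gamma (z + of_nat k) = pochhammer z k * Gamma z" if "z > 0" for z :: real
  proof -
    have "z \<notin> \<int>\<^sub>\<le>\<^sub>0" using that by (auto elim!: nonpos_Ints_cases)
    then show ?thesis using pochhammer_Gamma[of z k] Gamma_real_pos[OF that] by simp
  qed
  show ?thesis
    using assms *[of y] *[of "x + y"] by (simp add: Beta_def add.assoc[symmetric] mult_ac)
qed

text \<open>
  Testing against powers of \<open>1 + x\<close> rather than \<open>1 - x\<close> leaves a sum that the Chu--Vandermonde
  identity evaluates.
\<close>

lemma jacobi_explicit_orthogonal_power:
  assumes "\<alpha> > -1" "\<beta> > -1" "j < n"
  shows "(LBINT x:{-1<..<1}. poly (jacobi_explicit n \<alpha> \<beta>) x * ((1 + x) / 2) ^ j * jacobi_weight \<alpha> \<beta> x) = 0"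
proof -
  define b where "b = \<beta> + 1 + of_nat j"
  define K where "K = 2 powr (\<alpha> + \<beta> + 1) * Beta b (\<alpha> + 1) * (pochhammer (\<alpha> + 1) n / fact n)"
  have pos: "b > 0" "\<alpha> + 1 > 0" using assms by (auto simp: b_def)
  have "has_bochner_integral lborel (\<lambda>x. \<Sum>k\<le>n. jacobi_coeff n \<alpha> \<beta> k *
          (indicator {-1<..<1} x *\<^sub>R (((1 - x) / 2) ^ k * ((1 + x) / 2) ^ j * jacobi_weight \<alpha> \<beta> x)))
        (\<Sum>k\<le>n. jacobi_coeff n \<alpha> \<beta> k * (2 powr (\<alpha> + \<beta> + 1) * Beta b (\<alpha> + 1 + of_nat k)))"
    unfolding b_def
    by (intro has_bochner_integral_sum has_bochner_integral_mult_right has_bochner_integral_jacobi_weight assms)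
  also have "(\<lambda>x. \<Sum>k\<le>n. jacobi_coeff n \<alpha> \<beta> k *
          (indicator {-1<..<1} x *\<^sub>R (((1 - x) / 2) ^ k * ((1 + x) / 2) ^ j * jacobi_weight \<alpha> \<beta> x))) =
      (\<lambda>x. indicator {-1<..<1} x *\<^sub>R (poly (jacobi_explicit n \<alpha> \<beta>) x * ((1 + x) / 2) ^ j * jacobi_weight \<alpha> \<beta> x))"
    by (simp add: fun_eq_iff poly_jacobi_explicit sum_distrib_left sum_distrib_right mult_ac)
  also have "(\<Sum>k\<le>n. jacobi_coeff n \<alpha> \<beta> k * (2 powr (\<alpha> + \<beta> + 1) * Beta b (\<alpha> + 1 + of_nat k))) =
      K * (\<Sum>k=0..n. pochhammer (of_nat n + \<alpha> + \<beta> + 1) k * pochhammer (- of_nat n) k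
                      / (of_nat (fact k) * pochhammer (b + \<alpha> + 1) k))"
    unfolding sum_distrib_left atMost_atLeast0
  proof (rule sum.cong[OF refl])
    fix k
    have "pochhammer (\<alpha> + 1) k > 0" using pos by (intro pochhammer_pos)
    then show "jacobi_coeff n \<alpha> \<beta> k * (2 powr (\<alpha> + \<beta> + 1) * Beta b (\<alpha> + 1 + of_nat k)) =
      K * (pochhammer (of_nat n + \<alpha> + \<beta> + 1) k * pochhammer (- of_nat n) k
                      / (of_nat (fact k) * pochhammer (b + \<alpha> + 1) k))"
      unfolding Beta_plus_nat_right[OF pos] K_def jacobi_coeff_def add.assoc[symmetric]
      by (simp add: divide_simps)
  qed
  also have "(\<Sum>k=0..n. pochhammer (of_nat n + \<alpha> + \<beta> + 1) k * pochhammer (- of_nat n) k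
                      / (of_nat (fact k) * pochhammer (b + \<alpha> + 1) k)) =
       pochhammer (b + \<alpha> + 1 - (of_nat n + \<alpha> + \<beta> + 1)) n / pochhammer (b + \<alpha> + 1) n"
    by (rule Vandermonde_pochhammer) (use pos in auto)
  \<comment> \<open>The resulting base is a nonpositive integer of absolute value below
    \<open>n\<close>, so its Pochhammer symbol of length \<open>n\<close> contains the factor
    0.\<close>
  also have "b + \<alpha> + 1 - (of_nat n + \<alpha> + \<beta> + 1) = - of_nat (n - Suc j)"
    using assms(3) by (simp add: b_def of_nat_diff)
  also have "pochhammer (- of_nat (n - Suc j)) n = (0::real)"
    using assms(3) by (intro pochhammer_of_nat_eq_0_lemma) simp
  finally show ?thesis
    by (simp add: has_bochner_integral_iff set_lebesgue_integral_def)
qed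

lemma jacobi_explicit_orthogonal:
  assumes "\<alpha> > -1" "\<beta> > -1" "degree q < n"
  shows "(LBINT x:{-1<..<1}. poly (jacobi_explicit n \<alpha> \<beta>) x * poly q x * jacobi_weight \<alpha> \<beta> x) = 0"
proof -
  \<comment> \<open>\<open>r\<close> is \<open>q\<close> rewritten in the variable
    \<open>(1 + x) / 2\<close>; the affine change keeps the degree.\<close>
  define r where "r = pcompose q [:-1, 2:]"
  define P where "P = jacobi_explicit n \<alpha> \<beta>"
  have deg: "degree r < n" using assms(3) by (simp add: r_def degree_pcompose)
  have q: "poly q x = (\<Sum>j\<le>degree r. coeff r j * ((1 + x) / 2) ^ j)" for x
  proof -
    have "poly [:-1, 2:] ((1 + x) / 2) = x" by (simp add: algebra_simps)
    then have "poly q x = poly r ((1 + x) / 2)"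
      by (simp add: r_def poly_pcompose del: poly_pCons)
    then show ?thesis by (simp add: poly_altdef)
  qed
  have int: "set_integrable lborel {-1<..<1} (\<lambda>x. coeff r j * (poly P x * ((1 + x) / 2) ^ j * jacobi_weight \<alpha> \<beta> x))" for j
    using jacobi_weight_integrable[OF assms(1,2), of "P * [:1/2, 1/2:] ^ j"]
    by (intro set_integrable_mult_right) (simp add: add_divide_distrib)
  have "(LBINT x:{-1<..<1}. poly P x * poly q x * jacobi_weight \<alpha> \<beta> x) =
     (LBINT x:{-1<..<1}. \<Sum>j\<le>degree r. coeff r j * (poly P x * ((1 + x) / 2) ^ j * jacobi_weight \<alpha> \<beta> x))"
    unfolding q by (simp add: sum_distrib_left sum_distrib_right mult_ac)
  also have "\<dots> = (\<Sum>j\<le>degree r. LBINT x:{-1<..<1}. coeff r j * (poly P x * ((1 + x) / 2) ^ j * jacobi_weight \<alpha> \<beta> x))"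
    using int unfolding set_lebesgue_integral_def set_integrable_def scaleR_sum_right
    by (intro Bochner_Integration.integral_sum) auto
  also have "\<dots> = 0"
    using deg by (intro sum.neutral ballI)
      (simp add: P_def jacobi_explicit_orthogonal_power[OF assms(1,2)])
  finally show ?thesis by (simp add: P_def)
qed

text \<open>A nonnegative integrand with zero integral vanishes almost everywhere, but on the open
  interval this one vanishes only at the finitely many roots of a nonzero \<open>r\<close>.\<close>

lemma jacobi_weight_definite:
  assumes "\<alpha> > -1" "\<beta> > -1"
    and zero: "(LBINT x:{-1<..<1}. poly r x * poly r x * jacobi_weight \<alpha> \<beta> x) = 0"
  shows "r = 0"
proof (rule ccontr)
  assume "r \<noteq> 0"
  define f where "f = (\<lambda>x::real. indicator {-1<..<1} x *\<^sub>R (poly r x * poly r x * jacobi_weight \<alpha> \<beta> x))"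
  have "integrable lborel f"
    using jacobi_weight_integrable[OF assms(1,2), of "r * r"] by (simp add: f_def set_integrable_def)
  moreover have "integral\<^sup>L lborel f = 0"
    using zero by (simp add: f_def set_lebesgue_integral_def)
  moreover have "f x \<ge> 0" for x
    by (auto simp: f_def jacobi_weight_def indicator_def)
  ultimately have "AE x in lborel. f x = 0"
    by (subst (asm) integral_nonneg_eq_0_iff_AE) auto
  moreover have "AE x in lborel. x \<notin> {x. poly r x = 0}"
    using poly_roots_finite[OF \<open>r \<noteq> 0\<close>] by (intro AE_not_in finite_imp_null_set_lborel)
  ultimately have "AE x in lborel. x \<notin> {-1<..<1::real}"
    by eventually_elim (auto simp: f_def jacobi_weight_def)
  then have "emeasure lborel {-1<..<1::real} = 0"
    by (subst (asm) AE_iff_measurable[of "{-1<..<1}"]) auto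
  then show False by simp
qed

text \<open>Two candidates, scaled to have equal leading terms, differ by a polynomial of lower
  degree that is orthogonal to itself, hence zero. The value at 1 then fixes the scalar.\<close>

theorem jacobi_poly_eq_explicit:
  assumes "\<alpha> > -1" "\<beta> > -1"
  shows "jacobi_poly n \<alpha> \<beta> = jacobi_explicit n \<alpha> \<beta>"
  unfolding jacobi_poly_def jacobi_weight_def[symmetric]
proof (rule the_equality)
  let ?P = "jacobi_explicit n \<alpha> \<beta>"
  show "degree ?P = n \<and> poly ?P 1 = pochhammer (\<alpha> + 1) n / fact n \<and>
    (\<forall>q. degree q < n \<longrightarrow> (LBINT x:{-1<..<1}. poly ?P x * poly q x * jacobi_weight \<alpha> \<beta> x) = 0)"
    using degree_jacobi_explicit poly_jacobi_explicit_1 jacobi_explicit_orthogonal assms by blast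
  fix p
  assume p: "degree p = n \<and> poly p 1 = pochhammer (\<alpha> + 1) n / fact n \<and>
    (\<forall>q. degree q < n \<longrightarrow> (LBINT x:{-1<..<1}. poly p x * poly q x * jacobi_weight \<alpha> \<beta> x) = 0)"
  define a b where "a = lead_coeff ?P" and "b = lead_coeff p"
  \<comment> \<open>Cross-multiplication by the leading coefficients cancels the top term.\<close>
  define r where "r = smult a p - smult b ?P"
  have degP: "degree ?P = n" by (rule degree_jacobi_explicit[OF assms])
  have P1: "poly ?P 1 > 0" unfolding poly_jacobi_explicit_1
    using assms by (intro divide_pos_pos pochhammer_pos) auto
  then have a: "a \<noteq> 0" by (auto simp: a_def)
  have "r = 0"
  proof (cases "degree r < n")
    case True
    have int: "set_integrable lborel {-1<..<1} (\<lambda>x. poly u x * poly r x * jacobi_weight \<alpha> \<beta> x)" for u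
      using jacobi_weight_integrable[OF assms, of "u * r"] by simp
    have "(LBINT x:{-1<..<1}. poly r x * poly r x * jacobi_weight \<alpha> \<beta> x) =
       (LBINT x:{-1<..<1}. a * (poly p x * poly r x * jacobi_weight \<alpha> \<beta> x)
                         - b * (poly ?P x * poly r x * jacobi_weight \<alpha> \<beta> x))"
      by (intro set_lebesgue_integral_cong) (auto simp: r_def algebra_simps)
    also have "\<dots> = a * (LBINT x:{-1<..<1}. poly p x * poly r x * jacobi_weight \<alpha> \<beta> x)
                    - b * (LBINT x:{-1<..<1}. poly ?P x * poly r x * jacobi_weight \<alpha> \<beta> x)"
      by (subst set_integral_diff) (auto intro!: int)
    also have "\<dots> = 0"
      using p True jacobi_explicit_orthogonal[OF assms True] by simp
    finally show ?thesis by (rule jacobi_weight_definite[OF assms])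
  next
    \<comment> \<open>As the coefficient of index \<open>n\<close> cancels, this case arises only
      when \<open>n = 0\<close> and \<open>r\<close> is the zero polynomial.\<close>
    case False
    have "degree r \<le> n"
      unfolding r_def using p degP by (intro degree_diff_le order_trans[OF degree_smult_le]) auto
    with False have "degree r = n" by simp
    moreover have "coeff r n = 0"
      using p degP by (simp add: r_def a_def b_def)
    ultimately show ?thesis by (metis leading_coeff_0_iff)
  qed
  then have eq: "smult a p = smult b ?P" by (simp add: r_def)
  then have "a * poly p 1 = b * poly ?P 1" by (metis poly_smult)
  moreover have "poly p 1 = poly ?P 1" using p by (simp add: poly_jacobi_explicit_1)
  ultimately have "a = b" using P1 by simp
  with eq a show "p = ?P" by (metis smult_eq_iff)
qed

section \<open>Jacobi functions\<close>

text \<open>Integration by parts with vanishing boundary terms, as the limit of the fundamental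
  theorem on \<open>[-n, n]\<close>. The origin is exempt because the density of \<open>mu\<close>
  contains a power of \<open>|sinh t|\<close> that need not be differentiable there; continuity of
  \<open>F\<close> bridges the gap.\<close>

lemma LINT_total_derivative_eq_0:
  fixes F f :: "real \<Rightarrow> complex"
  assumes cont: "continuous_on UNIV F" and int: "integrable lborel f"
    and deriv: "\<And>t. t \<noteq> 0 \<Longrightarrow> (F has_vector_derivative f t) (at t)"
    and top: "(F \<longlongrightarrow> 0) at_top" and bot: "(F \<longlongrightarrow> 0) at_bot"
  shows "(LINT t|lborel. f t) = 0"
proof -
  have sint: "set_integrable lborel A f" if "A \<in> sets lborel" for A
    using int that unfolding set_integrable_def by (rule integrable_mult_indicator[rotated])
  have FTC: "(LINT t:{- real n..real n}|lborel. f t) = F (real n) - F (- real n)" for n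
  proof -
    have "(f has_integral (F (real n) - F (- real n))) {- real n..real n}"
      by (rule fundamental_theorem_of_calculus_strong[of "{0}"])
         (auto intro: deriv continuous_on_subset[OF cont])
    then show ?thesis
      using set_borel_integral_eq_integral(2)[OF sint, of "{- real n..real n}"]
      by (simp add: integral_unique)
  qed
  have "(\<lambda>n. LINT t:{- real n..real n}|lborel. f t) \<longlonglongrightarrow> (LINT t|lborel. f t)"
    unfolding set_lebesgue_integral_def
  proof (rule integral_dominated_convergence[where w = "\<lambda>t. norm (f t)"])
    show "AE t in lborel. (\<lambda>n. indicat_real {- real n..real n} t *\<^sub>R f t) \<longlonglongrightarrow> f t"
    proof (rule AE_I2, rule tendsto_eventually)
      fix t :: real
      obtain N where "\<bar>t\<bar> \<le> real N" using real_arch_simple by blast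
      then show "\<forall>\<^sub>F n in sequentially. indicat_real {- real n..real n} t *\<^sub>R f t = f t"
        by (intro eventually_sequentiallyI[of N]) (auto simp: indicator_def)
    qed
  qed (use int in \<open>auto simp: indicator_def intro!: borel_measurable_integrable\<close>)
  moreover have "(\<lambda>n. F (real n) - F (- real n)) \<longlonglongrightarrow> 0 - 0"
    by (intro tendsto_diff filterlim_compose[OF top] filterlim_compose[OF bot] filterlim_real_sequentially
        filterlim_compose[OF filterlim_uminus_at_bot_at_top])
  ultimately show ?thesis
    using LIMSEQ_unique by (fastforce simp: FTC)
qed

lemma LINT_odd_eq_0:
  fixes f :: "real \<Rightarrow> complex"
  assumes "\<And>t. f (- t) = - f t"
  shows "(LINT t|lborel. f t) = 0"
  using lborel_integral_real_affine[of "-1" f 0] assms by simp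

lemma integrable_exp_minus_abs:
  assumes "a > (0::real)"
  shows "integrable lborel (\<lambda>t::real. exp (- a * \<bar>t\<bar>))"
proof -
  have "set_integrable lebesgue {0..} (\<lambda>t::real. exp (- a * t))"
    using integrable_on_exp_minus_to_infinity[OF assms, of 0]
    by (intro nonnegative_absolutely_integrable_1) auto
  then have "set_integrable lborel {0..} (\<lambda>t::real. exp (- a * t))"
    unfolding set_integrable_def by (subst (asm) integrable_completion) auto
  then have "integrable lborel (\<lambda>t. indicator {0..} t *\<^sub>R exp (- a * \<bar>t\<bar>))"
    unfolding set_integrable_def
    by (rule Bochner_Integration.integrable_cong[THEN iffD1, rotated 2]) (auto simp: indicator_def)
  then have "has_bochner_integral lborel (\<lambda>t. indicator {0..} t *\<^sub>R exp (- a * \<bar>t\<bar>))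
               (LINT t|lborel. indicator {0..} t *\<^sub>R exp (- a * \<bar>t\<bar>))"
    by (simp add: has_bochner_integral_iff)
  from has_bochner_integral_even_function[OF this] show ?thesis
    by (simp add: has_bochner_integral_iff)
qed

lemma cosh_powr_minus_le:
  fixes t \<delta> :: real
  assumes "\<delta> > 0"
  shows "cosh t powr (- \<delta>) \<le> 2 powr \<delta> * exp (- \<delta> * \<bar>t\<bar>)"
proof -
  have "exp \<bar>t\<bar> / 2 \<le> cosh t"
    by (auto simp: cosh_def abs_if field_simps)
  then have "cosh t powr (- \<delta>) \<le> (exp \<bar>t\<bar> / 2) powr (- \<delta>)"
    using assms by (intro powr_mono2') auto
  also have "\<dots> = 2 powr \<delta> * exp (- \<delta> * \<bar>t\<bar>)"
    by (simp add: powr_divide powr_minus_divide exp_powr_real exp_minus field_simps)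
  finally show ?thesis .
qed

lemma not_nonpos_Int:
  fixes z :: complex
  assumes "Re z > 0"
  shows "z \<notin> \<int>\<^sub>\<le>\<^sub>0"
  using assms by (auto elim!: nonpos_Ints_cases)

section \<open>The Jacobi function and its boundedness\<close>

locale jacobi_function =
  fixes b \<iota> :: real and \<nu> :: complex
  assumes b_pos: "b > 0" and \<iota>_pos: "\<iota> > 0" and Re_\<nu>: "Re \<nu> = 0"
begin

abbreviation "\<rho> \<equiv> rho b \<iota>"

definition "\<Phi> = hyp2F1 ((\<nu> + of_real \<rho>) / 2) ((- \<nu> + of_real \<rho>) / 2) (of_real ((1 + \<iota>) / 2 + b))"

definition arg :: "real \<Rightarrow> complex" where "arg t = - (of_real (sinh t))\<^sup>2"

definition \<phi> :: "real \<Rightarrow> complex" where "\<phi> t = \<Phi> (arg t)"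

text \<open>The derivative of \<open>\<phi>\<close> by the chain rule, as
  \<open>has_vector_derivative_\<phi>\<close> confirms; in this form it is visibly the odd part of
  \<open>G_fun\<close> up to the factor \<open>- 1 / (\<nu> + \<rho>)\<close>.\<close>

definition \<phi>' :: "real \<Rightarrow> complex" where "\<phi>' t = - (sinh (2 * t) *\<^sub>R deriv \<Phi> (arg t))"

text \<open>The negated eigenvalue \<open>\<rho>\<^sup>2 - \<nu>\<^sup>2\<close>, written through
  \<open>Im \<nu>\<close> so that it is a real and visibly positive number.\<close>

definition \<kappa> :: real where "\<kappa> = \<rho>\<^sup>2 + (Im \<nu>)\<^sup>2"

definition dens :: "real \<Rightarrow> real" where
  "dens t = 2 powr (2 * b + \<iota>) * \<bar>sinh t\<bar> powr (2 * b) * \<bar>sinh (2 * t)\<bar> powr \<iota>"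

lemma \<rho>_pos: "\<rho> > 0"
  using b_pos \<iota>_pos by (simp add: rho_def)

lemma \<kappa>_pos: "\<kappa> > 0"
  using \<rho>_pos by (simp add: \<kappa>_def add_pos_nonneg)

lemma of_real_\<kappa>: "of_real \<kappa> = (of_real \<rho>)\<^sup>2 - \<nu>\<^sup>2"
  using Re_\<nu> by (simp add: \<kappa>_def complex_eq_iff power2_eq_square)

lemma \<nu>_plus_\<rho>_nonzero: "\<nu> + of_real \<rho> \<noteq> 0"
  using \<rho>_pos Re_\<nu> by (auto simp: complex_eq_iff)

text \<open>The three real parts are \<open>\<rho> / 2\<close>, \<open>(b + 1) / 2\<close> and
  \<open>(1 + \<iota>) / 2 + b\<close>, all positive.\<close>

lemma params:
  "(\<nu> + of_real \<rho>) / 2 \<notin> \<int>\<^sub>\<le>\<^sub>0"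
  "of_real ((1 + \<iota>) / 2 + b) - (- \<nu> + of_real \<rho>) / 2 \<notin> \<int>\<^sub>\<le>\<^sub>0"
  "of_real ((1 + \<iota>) / 2 + b) \<notin> (\<int>\<^sub>\<le>\<^sub>0 :: complex set)"
  using b_pos \<iota>_pos Re_\<nu> by (auto intro!: not_nonpos_Int simp: rho_def field_simps)

lemma Re_arg: "Re (arg t) < 1/2"
proof -
  have "Re (arg t) = - (sinh t)\<^sup>2" by (simp add: arg_def)
  also have "\<dots> \<le> 0" by simp
  finally show ?thesis by simp
qed

lemma has_vector_derivative_arg: "(arg has_vector_derivative - of_real (sinh (2 * t))) (at t)"
proof -
  have "((\<lambda>t. - (sinh t)\<^sup>2) has_real_derivative - sinh (2 * t)) (at t)"
    by (auto intro!: derivative_eq_intros simp: sinh_double)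
  then have "((\<lambda>t. of_real (- (sinh t)\<^sup>2) :: complex) has_vector_derivative of_real (- sinh (2 * t))) (at t)"
    by (intro has_vector_derivative_of_real) (simp add: has_real_derivative_iff_has_vector_derivative)
  then show ?thesis by (simp add: arg_def[abs_def])
qed

lemma \<Phi>_holomorphic: "\<Phi> holomorphic_on {z. Re z < 1/2}"
  unfolding \<Phi>_def by (rule hyp2F1_holomorphic[OF params])

lemma has_vector_derivative_\<phi>: "(\<phi> has_vector_derivative \<phi>' t) (at t)"
proof -
  have "(\<Phi> has_field_derivative deriv \<Phi> (arg t)) (at (arg t))"
    using Re_arg by (intro holomorphic_derivI[OF \<Phi>_holomorphic open_halfspace_Re_lt]) simp
  from field_vector_diff_chain_at[OF has_vector_derivative_arg this]
  show ?thesis by (simp add: \<phi>_def[abs_def] \<phi>'_def o_def scaleR_conv_of_real)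
qed

text \<open>The hypergeometric equation removes the second derivative of \<open>\<Phi>\<close>.
  Keeping \<open>deriv \<Phi> (arg t)\<close> instead of \<open>\<phi>' t\<close> divided by
  \<open>sinh (2 * t)\<close> makes the formula valid at the origin too.\<close>

lemma has_vector_derivative_\<phi>':
  "(\<phi>' has_vector_derivative
     - (\<kappa> *\<^sub>R \<phi> t) + (4 * b + 2 * \<iota> + 4 * \<rho> * (sinh t)\<^sup>2) *\<^sub>R deriv \<Phi> (arg t)) (at t)"
proof -
  define x where "x = arg t"
  define s where "s = (of_real (sinh t) :: complex)"
  define c where "c = (of_real (cosh t) :: complex)"
  have cs: "c^2 = 1 + s^2"
    unfolding c_def s_def by (simp add: cosh_square_eq flip: of_real_power)
  have x: "x = - (s^2)" by (simp add: x_def s_def arg_def)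
  have "deriv \<Phi> holomorphic_on {z. Re z < 1/2}"
    by (intro holomorphic_deriv \<Phi>_holomorphic open_halfspace_Re_lt)
  then have "(deriv \<Phi> has_field_derivative deriv (deriv \<Phi>) x) (at x)"
    by (rule holomorphic_derivI[OF _ open_halfspace_Re_lt]) (use Re_arg in \<open>simp add: x_def\<close>)
  from field_vector_diff_chain_at[OF has_vector_derivative_arg this[unfolded x_def]]
  have d: "((\<lambda>t. deriv \<Phi> (arg t)) has_vector_derivative - of_real (sinh (2 * t)) * deriv (deriv \<Phi>) x) (at t)"
    by (simp add: o_def x_def)
  have "((\<lambda>t. sinh (2 * t)) has_real_derivative 2 * cosh (2 * t)) (at t)"
    by (auto intro!: derivative_eq_intros)
  from has_vector_derivative_minus[OF has_vector_derivative_scaleR[OF this d]]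
  have D: "(\<phi>' has_vector_derivative
      - (sinh (2 * t) *\<^sub>R (- of_real (sinh (2 * t)) * deriv (deriv \<Phi>) x) + (2 * cosh (2 * t)) *\<^sub>R deriv \<Phi> x)) (at t)"
    by (simp add: \<phi>'_def[abs_def] x_def)
  \<comment> \<open>The two upper parameters have sum \<open>\<rho>\<close> and product
    \<open>\<kappa> / 4\<close>.\<close>
  have ode: "x * (1 - x) * deriv (deriv \<Phi>) x
      + (of_real ((1 + \<iota>) / 2 + b) - (of_real \<rho> + 1) * x) * deriv \<Phi> x
      - (of_real \<kappa> / 4) * \<Phi> x = 0"
    using hyp2F1_ode[OF params, of x] Re_arg[of t]
    by (simp add: \<Phi>_def x_def of_real_\<kappa> field_simps power2_eq_square)
  have S: "of_real (sinh (2 * t)) = 2 * s * c"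
    by (simp add: sinh_double s_def c_def)
  have C: "of_real (cosh (2 * t)) = 1 + 2 * s^2"
    using cs by (simp add: cosh_double s_def c_def)
  have "- (of_real (sinh (2 * t)) * (- of_real (sinh (2 * t)) * deriv (deriv \<Phi>) x) + of_real (2 * cosh (2 * t)) * deriv \<Phi> x)
     = 4 * s^2 * c^2 * deriv (deriv \<Phi>) x - 2 * (1 + 2 * s^2) * deriv \<Phi> x"
    by (simp only: S C of_real_mult of_real_numeral) (simp add: power2_eq_square algebra_simps)
  also have "4 * s^2 * c^2 * deriv (deriv \<Phi>) x = - 4 * (x * (1 - x) * deriv (deriv \<Phi>) x)"
    by (simp add: x cs)
  also have "x * (1 - x) * deriv (deriv \<Phi>) x = (of_real \<kappa> / 4) * \<Phi> x
      - (of_real ((1 + \<iota>) / 2 + b) - (of_real \<rho> + 1) * x) * deriv \<Phi> x"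
    using ode by (simp add: algebra_simps)
  also have "- 4 * ((of_real \<kappa> / 4) * \<Phi> x
      - (of_real ((1 + \<iota>) / 2 + b) - (of_real \<rho> + 1) * x) * deriv \<Phi> x) - 2 * (1 + 2 * s^2) * deriv \<Phi> x
     = - (of_real \<kappa> * \<Phi> x) + (4 * of_real b + 2 * of_real \<iota> + 4 * of_real \<rho> * s^2) * deriv \<Phi> x"
    by (simp add: x algebra_simps add_divide_distrib)
  finally show ?thesis
    using D by (simp add: \<phi>_def x_def s_def scaleR_conv_of_real)
qed

lemma continuous_\<phi> [continuous_intros]: "continuous_on A \<phi>"
  using has_vector_derivative_\<phi> has_vector_derivative_continuous continuous_at_imp_continuous_on by blast

lemma continuous_\<phi>' [continuous_intros]: "continuous_on A \<phi>'"
  using has_vector_derivative_\<phi>' has_vector_derivative_continuous continuous_at_imp_continuous_on by blast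

lemma arg_minus [simp]: "arg (- t) = arg t"
  by (simp add: arg_def)

lemma \<phi>_minus [simp]: "\<phi> (- t) = \<phi> t"
  by (simp add: \<phi>_def)

lemma \<phi>'_minus [simp]: "\<phi>' (- t) = - \<phi>' t"
  by (simp add: \<phi>'_def)

text \<open>The energy \<open>|\<phi>'|\<^sup>2 + \<kappa> |\<phi>|\<^sup>2\<close> decreases on the positive half-line.\<close>

lemma energy_bound:
  "(norm (\<phi>' t))\<^sup>2 + \<kappa> * (norm (\<phi> t))\<^sup>2 \<le> (norm (\<phi>' 0))\<^sup>2 + \<kappa> * (norm (\<phi> 0))\<^sup>2"
proof -
  define E where "E = (\<lambda>t. \<phi>' t \<bullet> \<phi>' t + \<kappa> * (\<phi> t \<bullet> \<phi> t))"
  define q where "q = (\<lambda>t. 4 * b + 2 * \<iota> + 4 * \<rho> * (sinh t)\<^sup>2)"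
  have q_pos: "q t > 0" for t
    using b_pos \<iota>_pos \<rho>_pos by (simp add: q_def add_pos_nonneg)
  have E': "(E has_real_derivative - 2 * sinh (2 * t) * q t * (norm (deriv \<Phi> (arg t)))\<^sup>2) (at t)" for t
  proof -
    define d where "d = deriv \<Phi> (arg t)"
    define p where "p = - (\<kappa> *\<^sub>R \<phi> t) + q t *\<^sub>R d"
    have "(\<phi>' has_vector_derivative p) (at t)"
      using has_vector_derivative_\<phi>' by (simp add: p_def q_def d_def)
    note bounded_bilinear.has_vector_derivative[OF bounded_bilinear_inner this this]
      bounded_bilinear.has_vector_derivative[OF bounded_bilinear_inner has_vector_derivative_\<phi>[of t] has_vector_derivative_\<phi>[of t]]
    note this[folded has_real_derivative_iff_has_vector_derivative]
    from DERIV_add[OF this(1) DERIV_cmult[OF this(2), of \<kappa>]]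
    have "(E has_real_derivative (\<phi>' t \<bullet> p + p \<bullet> \<phi>' t) + \<kappa> * (\<phi> t \<bullet> \<phi>' t + \<phi>' t \<bullet> \<phi> t)) (at t)"
      by (simp add: E_def)
    \<comment> \<open>The \<open>\<kappa>\<close> terms cancel, leaving the damping term. Its sign
      is known because \<open>\<phi>' t\<close> is itself \<open>- sinh (2 * t)\<close> times
      \<open>d\<close>.\<close>
    moreover have "(\<phi>' t \<bullet> p + p \<bullet> \<phi>' t) + \<kappa> * (\<phi> t \<bullet> \<phi>' t + \<phi>' t \<bullet> \<phi> t) = 2 * q t * (\<phi>' t \<bullet> d)"
      by (simp add: p_def inner_add_right inner_diff_right inner_commute algebra_simps)
    moreover have "\<phi>' t \<bullet> d = - sinh (2 * t) * (norm d)\<^sup>2"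
      by (simp add: \<phi>'_def d_def power2_norm_eq_inner)
    ultimately show ?thesis by (simp add: d_def mult_ac)
  qed
  have pos: "E t \<le> E 0" if "t \<ge> 0" for t
    using that
  proof (rule DERIV_nonpos_imp_nonincreasing)
    fix x assume "0 \<le> x" "x \<le> t"
    with E'[of x] q_pos[of x] show "\<exists>y. (E has_real_derivative y) (at x) \<and> y \<le> 0"
      by (intro exI conjI) (auto intro!: mult_nonneg_nonneg simp: less_imp_le)
  qed
  have "E t = E \<bar>t\<bar>" by (simp add: E_def abs_if)
  with pos[of "\<bar>t\<bar>"] show ?thesis by (simp add: E_def power2_norm_eq_inner)
qed

text \<open>Both summands of the energy are nonnegative, so each is bounded by the energy at 0. An
  imaginary \<open>\<nu>\<close> enters through \<open>\<kappa> > 0\<close>.\<close>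

lemma \<phi>_bounded: obtains B where "\<And>t. norm (\<phi> t) \<le> B" "\<And>t. norm (\<phi>' t) \<le> B"
proof -
  define E where "E = (norm (\<phi>' 0))\<^sup>2 + \<kappa> * (norm (\<phi> 0))\<^sup>2"
  have "(norm (\<phi>' t))\<^sup>2 \<le> E" "\<kappa> * (norm (\<phi> t))\<^sup>2 \<le> E" for t
    using energy_bound[of t] \<kappa>_pos mult_nonneg_nonneg[of \<kappa> "(norm (\<phi> t))\<^sup>2"]
    by (auto simp: E_def intro: order_trans[rotated])
  then have "norm (\<phi>' t) \<le> sqrt E" "norm (\<phi> t) \<le> sqrt (E / \<kappa>)" for t
    using \<kappa>_pos by (auto intro!: real_le_rsqrt simp: field_simps)
  then have "norm (\<phi> t) \<le> max (sqrt E) (sqrt (E / \<kappa>))" "norm (\<phi>' t) \<le> max (sqrt E) (sqrt (E / \<kappa>))" for t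
    by (simp_all add: le_max_iff_disj)
  then show ?thesis by (rule that)
qed

section \<open>The density of the measure\<close>

lemma dens_altdef: "dens t = 2 powr (2 * \<rho>) * (\<bar>sinh t\<bar> powr (2 * b + \<iota>) * cosh t powr \<iota>)"
proof -
  have "\<bar>sinh (2 * t)\<bar> powr \<iota> = 2 powr \<iota> * \<bar>sinh t\<bar> powr \<iota> * cosh t powr \<iota>"
    by (simp add: sinh_double abs_mult powr_mult)
  then show ?thesis
    by (simp add: dens_def rho_def powr_add algebra_simps mult_2 flip: powr_add)
qed

lemma dens_nonneg: "dens t \<ge> 0"
  by (simp add: dens_def)

lemma dens_minus [simp]: "dens (- t) = dens t"
  by (simp add: dens_def)

lemma continuous_dens: "continuous_on A dens"
  unfolding dens_altdef[abs_def] using b_pos \<iota>_pos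
  by (intro continuous_intros continuous_on_powr') auto

lemma dens_le: "dens t \<le> 2 powr (2 * \<rho>) * cosh t powr (2 * \<rho>)"
proof -
  have "\<bar>sinh t\<bar> \<le> cosh t"
    using sinh_less_cosh_real[of "\<bar>t\<bar>"] by (simp add: abs_if split: if_splits)
  then have "\<bar>sinh t\<bar> powr (2 * b + \<iota>) \<le> cosh t powr (2 * b + \<iota>)"
    using b_pos \<iota>_pos by (intro powr_mono2) auto
  then have "\<bar>sinh t\<bar> powr (2 * b + \<iota>) * cosh t powr \<iota> \<le> cosh t powr (2 * b + \<iota>) * cosh t powr \<iota>"
    by (intro mult_right_mono) auto
  also have "\<dots> = cosh t powr (2 * \<rho>)"
    by (simp only: powr_add[symmetric]) (simp add: rho_def algebra_simps)
  finally show ?thesis by (simp add: dens_altdef)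
qed

lemma DERIV_dens:
  assumes "t \<noteq> 0"
  shows "(dens has_real_derivative
            dens t * ((2 * b + \<iota>) * cosh t / sinh t + \<iota> * sinh t / cosh t)) (at t)"
proof -
  \<comment> \<open>Half the exponent: powers of \<open>|sinh t|\<close> become powers of the smooth
    function \<open>sinh\<^sup>2\<close>, which handles both signs of \<open>t\<close>
    together.\<close>
  define p where "p = (2 * b + \<iota>) / 2"
  have eq: "dens = (\<lambda>t. 2 powr (2 * \<rho>) * (((sinh t)\<^sup>2) powr p * cosh t powr \<iota>))"
  proof
    fix t
    have "((sinh t)\<^sup>2) powr p = \<bar>sinh t\<bar> powr (2 * b + \<iota>)"
    proof -
      have "((sinh t)\<^sup>2) powr p = (\<bar>sinh t\<bar> powr 2) powr p" by simp
      also have "\<dots> = \<bar>sinh t\<bar> powr (2 * p)" by (rule powr_powr)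
      also have "2 * p = 2 * b + \<iota>" by (simp add: p_def)
      finally show ?thesis .
    qed
    then show "dens t = 2 powr (2 * \<rho>) * (((sinh t)\<^sup>2) powr p * cosh t powr \<iota>)"
      by (simp add: dens_altdef)
  qed
  have s: "sinh t \<noteq> 0" using assms by simp
  have "((\<lambda>z. z powr p) has_real_derivative p * ((sinh t)\<^sup>2) powr (p - 1)) (at ((sinh t)\<^sup>2))"
    using s by (intro has_real_derivative_powr) simp
  moreover have "((\<lambda>t. (sinh t)\<^sup>2) has_real_derivative 2 * sinh t * cosh t) (at t)"
    by (auto intro!: derivative_eq_intros)
  ultimately have 1: "((\<lambda>t. ((sinh t)\<^sup>2) powr p) has_real_derivative
      p * ((sinh t)\<^sup>2) powr (p - 1) * (2 * sinh t * cosh t)) (at t)"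
    by (rule DERIV_chain2)
  have 2: "((\<lambda>t. cosh t powr \<iota>) has_real_derivative \<iota> * cosh t powr (\<iota> - 1) * sinh t) (at t)"
    by (rule DERIV_chain2[OF has_real_derivative_powr]) (auto intro!: derivative_eq_intros)
  show ?thesis
    unfolding eq
  proof (rule DERIV_cong[OF DERIV_cmult[OF DERIV_mult[OF 1 2]]])
    have e1: "((sinh t)\<^sup>2) powr (p - 1) = ((sinh t)\<^sup>2) powr p / (sinh t)\<^sup>2"
      using s by (simp add: powr_diff)
    have e2: "cosh t powr (\<iota> - 1) = cosh t powr \<iota> / cosh t"
      by (simp add: powr_diff)
    have alg: "K * (p * (x / u\<^sup>2) * (2 * u * c) * y + \<iota> * (y / c) * u * x)
        = K * (x * y) * (2 * p * c / u + \<iota> * u / c)" if "u \<noteq> 0" "c \<noteq> 0" for K x y u c :: real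
      using that by (simp add: field_simps power2_eq_square)
    have p2: "2 * b + \<iota> = 2 * p" by (simp add: p_def)
    show "2 powr (2 * \<rho>) * (p * ((sinh t)\<^sup>2) powr (p - 1) * (2 * sinh t * cosh t) * cosh t powr \<iota>
          + \<iota> * cosh t powr (\<iota> - 1) * sinh t * ((sinh t)\<^sup>2) powr p)
        = 2 powr (2 * \<rho>) * (((sinh t)\<^sup>2) powr p * cosh t powr \<iota>)
          * ((2 * b + \<iota>) * cosh t / sinh t + \<iota> * sinh t / cosh t)"
      unfolding e1 e2 p2 using s by (intro alg) auto
  qed
qed

text \<open>The eigenvalue equation in divergence form: the logarithmic derivative of
  \<open>dens\<close>, times \<open>\<phi>'\<close>, cancels the first-order term in the derivative
  of \<open>\<phi>'\<close>.\<close>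

lemma has_vector_derivative_dens_\<phi>':
  assumes "t \<noteq> 0"
  shows "((\<lambda>t. dens t *\<^sub>R \<phi>' t) has_vector_derivative - ((\<kappa> * dens t) *\<^sub>R \<phi> t)) (at t)"
proof -
  define d where "d = deriv \<Phi> (arg t)"
  have s: "sinh t \<noteq> 0" using assms by simp
  have D: "((\<lambda>t. dens t *\<^sub>R \<phi>' t) has_vector_derivative
      dens t *\<^sub>R (- (\<kappa> *\<^sub>R \<phi> t) + (4 * b + 2 * \<iota> + 4 * \<rho> * (sinh t)\<^sup>2) *\<^sub>R d)
      + (dens t * ((2 * b + \<iota>) * cosh t / sinh t + \<iota> * sinh t / cosh t)) *\<^sub>R \<phi>' t) (at t)"
    unfolding d_def by (rule has_vector_derivative_scaleR[OF DERIV_dens[OF assms] has_vector_derivative_\<phi>'])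
  have "((2 * b + \<iota>) * cosh t / sinh t + \<iota> * sinh t / cosh t) * sinh (2 * t)
      = 2 * ((2 * b + \<iota>) * (cosh t)\<^sup>2 + \<iota> * (sinh t)\<^sup>2)"
    unfolding sinh_double using s by (simp add: field_simps power2_eq_square)
  also have "\<dots> = 4 * b + 2 * \<iota> + 4 * \<rho> * (sinh t)\<^sup>2"
    by (simp add: cosh_square_eq rho_def algebra_simps)
  finally have "((2 * b + \<iota>) * cosh t / sinh t + \<iota> * sinh t / cosh t) *\<^sub>R \<phi>' t
      = - ((4 * b + 2 * \<iota> + 4 * \<rho> * (sinh t)\<^sup>2) *\<^sub>R d)"
    by (simp add: \<phi>'_def d_def)
  then have "(dens t * ((2 * b + \<iota>) * cosh t / sinh t + \<iota> * sinh t / cosh t)) *\<^sub>R \<phi>' t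
      = dens t *\<^sub>R - ((4 * b + 2 * \<iota> + 4 * \<rho> * (sinh t)\<^sup>2) *\<^sub>R d)"
    by (metis scaleR_scaleR)
  with D show ?thesis by (simp add: algebra_simps)
qed

section \<open>Powers of the hyperbolic cosine and their decay\<close>

lemma DERIV_w_fun: "(w_fun \<sigma> has_real_derivative - \<sigma> * (w_fun \<sigma> t * tanh t)) (at t)"
proof -
  have "((\<lambda>t. cosh t powr (- \<sigma>)) has_real_derivative (- \<sigma> * cosh t powr (- \<sigma> - 1)) * sinh t) (at t)"
    by (rule DERIV_chain2[OF has_real_derivative_powr]) (auto intro!: derivative_eq_intros)
  then show ?thesis
    by (simp add: w_fun_def[abs_def] tanh_def powr_diff mult_ac)
qed

lemma w_fun_add_2: "w_fun (\<sigma> + 2 * real k) t = w_fun \<sigma> t * (1 - (tanh t)\<^sup>2) ^ k"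
proof -
  have "1 - (tanh t)\<^sup>2 = 1 / (cosh t)\<^sup>2"
    by (simp add: tanh_def field_simps sinh_square_eq)
  then have "(1 - (tanh t)\<^sup>2) ^ k = 1 / cosh t ^ (2 * k)"
    by (simp add: power_divide power_mult)
  also have "cosh t ^ (2 * k) = cosh t powr (2 * real k)"
    by (simp flip: powr_realpow)
  finally show ?thesis by (simp add: w_fun_def powr_diff powr_minus_divide)
qed

lemma continuous_w_fun: "continuous_on A (w_fun \<sigma>)"
  unfolding w_fun_def[abs_def] by (intro continuous_intros) auto

lemma w_fun_nonneg: "w_fun \<sigma> t \<ge> 0"
  by (simp add: w_fun_def)

lemma w_fun_minus [simp]: "w_fun \<sigma> (- t) = w_fun \<sigma> t"
  by (simp add: w_fun_def)

text \<open>Multiplied by \<open>- \<sigma>\<close> this is the divergence form of the radial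
  operator applied to \<open>w_fun \<sigma>\<close>, since \<open>w_fun \<sigma> t * tanh t\<close>
  is the derivative of \<open>w_fun \<sigma>\<close> up to that factor.\<close>

lemma DERIV_dens_w_tanh:
  assumes "t \<noteq> 0"
  shows "((\<lambda>t. dens t * (w_fun \<sigma> t * tanh t)) has_real_derivative
     dens t * ((2 * \<rho> - \<sigma>) * w_fun \<sigma> t + (\<sigma> + 1 - \<iota>) * w_fun (\<sigma> + 2) t)) (at t)"
proof -
  have s: "sinh t \<noteq> 0" using assms by simp
  have T: "(tanh has_real_derivative 1 - (tanh t)\<^sup>2) (at t)"
    by (auto intro!: derivative_eq_intros)
  have w2: "w_fun (\<sigma> + 2) t = w_fun \<sigma> t * (1 - (tanh t)\<^sup>2)"
    using w_fun_add_2[of \<sigma> 1 t] by simp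
  have "((2 * b + \<iota>) * cosh t / sinh t + \<iota> * sinh t / cosh t) * tanh t = 2 * b + \<iota> + \<iota> * (tanh t)\<^sup>2"
    using s by (simp add: tanh_def field_simps power2_eq_square)
  then have "(dens t * ((2 * b + \<iota>) * cosh t / sinh t + \<iota> * sinh t / cosh t)) * (w_fun \<sigma> t * tanh t)
      = dens t * w_fun \<sigma> t * (2 * b + \<iota> + \<iota> * (tanh t)\<^sup>2)"
    by (metis mult.assoc mult.commute)
  then show ?thesis
    by (intro DERIV_cong[OF DERIV_mult[OF DERIV_dens[OF assms] DERIV_mult[OF DERIV_w_fun T]]])
       (simp add: w2 rho_def algebra_simps power2_eq_square)
qed

text \<open>The density grows at most like \<open>cosh t powr (2 * \<rho>)\<close>, so the gap
  \<open>\<sigma> - 2 * \<rho>\<close> becomes a rate of exponential decay.\<close>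

lemma dens_w_le:
  assumes "\<sigma> > 2 * \<rho>"
  shows "dens t * w_fun \<sigma> t \<le> 2 powr \<sigma> * exp (- (\<sigma> - 2 * \<rho>) * \<bar>t\<bar>)"
proof -
  have "dens t * w_fun \<sigma> t \<le> 2 powr (2 * \<rho>) * cosh t powr (2 * \<rho>) * w_fun \<sigma> t"
    by (intro mult_right_mono dens_le w_fun_nonneg)
  also have "\<dots> = 2 powr (2 * \<rho>) * cosh t powr (- (\<sigma> - 2 * \<rho>))"
    by (simp add: w_fun_def flip: powr_add)
  also have "\<dots> \<le> 2 powr (2 * \<rho>) * (2 powr (\<sigma> - 2 * \<rho>) * exp (- (\<sigma> - 2 * \<rho>) * \<bar>t\<bar>))"
    using assms by (intro mult_left_mono cosh_powr_minus_le) auto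
  also have "\<dots> = 2 powr \<sigma> * exp (- (\<sigma> - 2 * \<rho>) * \<bar>t\<bar>)"
    by (simp add: powr_diff)
  finally show ?thesis .
qed

lemma integrable_dens_w:
  fixes u :: "real \<Rightarrow> complex"
  assumes "\<sigma> > 2 * \<rho>" and u: "continuous_on UNIV u" and B: "\<And>t. norm (u t) \<le> B"
  shows "integrable lborel (\<lambda>t. (dens t * w_fun \<sigma> t) *\<^sub>R u t)"
proof (rule Bochner_Integration.integrable_bound)
  show "integrable lborel (\<lambda>t. 2 powr \<sigma> * exp (- (\<sigma> - 2 * \<rho>) * \<bar>t\<bar>) * B)"
    using assms(1) by (intro integrable_mult_left integrable_mult_right integrable_exp_minus_abs) auto
  show "(\<lambda>t. (dens t * w_fun \<sigma> t) *\<^sub>R u t) \<in> borel_measurable lborel"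
    unfolding measurable_lborel2
    by (intro borel_measurable_continuous_onI continuous_intros continuous_dens continuous_w_fun u)
  show "AE t in lborel. norm ((dens t * w_fun \<sigma> t) *\<^sub>R u t) \<le> norm (2 powr \<sigma> * exp (- (\<sigma> - 2 * \<rho>) * \<bar>t\<bar>) * B)"
  proof (rule AE_I2)
    fix t
    have "B \<ge> 0" using B[of 0] norm_ge_zero order_trans by blast
    then show "norm ((dens t * w_fun \<sigma> t) *\<^sub>R u t) \<le> norm (2 powr \<sigma> * exp (- (\<sigma> - 2 * \<rho>) * \<bar>t\<bar>) * B)"
      using mult_mono[OF dens_w_le[OF assms(1), of t] B[of t]]
      by (simp add: abs_mult dens_nonneg w_fun_nonneg)
  qed
qed

text \<open>Stated for any filter below \<open>at_infinity\<close>, it supplies the boundary terms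
  at both ends of the line.\<close>

lemma tendsto_dens_w:
  fixes u :: "real \<Rightarrow> complex"
  assumes \<sigma>: "\<sigma> > 2 * \<rho>" and B: "\<And>t. norm (u t) \<le> B" and F: "F \<le> at_infinity"
  shows "((\<lambda>t. (dens t * w_fun \<sigma> t) *\<^sub>R u t) \<longlongrightarrow> 0) F"
proof (rule tendsto_mono[OF F], rule Lim_null_comparison)
  have "B \<ge> 0" using B[of 0] norm_ge_zero order_trans by blast
  then show "\<forall>\<^sub>F t in at_infinity. norm ((dens t * w_fun \<sigma> t) *\<^sub>R u t) \<le> 2 powr \<sigma> * exp (- (\<sigma> - 2 * \<rho>) * \<bar>t\<bar>) * B"
    using mult_mono[OF dens_w_le[OF \<sigma>] B]
    by (intro always_eventually) (simp add: abs_mult dens_nonneg w_fun_nonneg)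
  have "((\<lambda>x. exp (- (\<sigma> - 2 * \<rho>) * x)) \<longlongrightarrow> 0) at_top"
    using \<sigma> by real_asymp
  then have "((\<lambda>t::real. exp (- (\<sigma> - 2 * \<rho>) * \<bar>t\<bar>)) \<longlongrightarrow> 0) at_infinity"
    by (rule filterlim_compose)
       (use filterlim_at_infinity_imp_norm_at_top[OF filterlim_ident[of "at_infinity :: real filter"]] in simp)
  then have "((\<lambda>t::real. 2 powr \<sigma> * exp (- (\<sigma> - 2 * \<rho>) * \<bar>t\<bar>) * B) \<longlongrightarrow> 2 powr \<sigma> * 0 * B) at_infinity"
    by (intro tendsto_intros)
  then show "((\<lambda>t::real. 2 powr \<sigma> * exp (- (\<sigma> - 2 * \<rho>) * \<bar>t\<bar>) * B) \<longlongrightarrow> 0) at_infinity"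
    by simp
qed

lemma continuous_tanh_scaleR_\<phi>: "continuous_on A (\<lambda>t. tanh t *\<^sub>R \<phi> t)" "continuous_on A (\<lambda>t. tanh t *\<^sub>R \<phi>' t)"
  by (intro continuous_intros; simp)+

lemma norm_tanh_scaleR_le:
  fixes x :: complex
  shows "norm (tanh t *\<^sub>R x) \<le> norm x"
proof -
  have "\<bar>tanh t\<bar> \<le> 1" using tanh_real_lt_1[of t] tanh_real_gt_neg1[of t] by simp
  then show ?thesis by (simp add: mult_left_le_one_le)
qed

lemma integrable_\<phi>:
  assumes "\<sigma> > 2 * \<rho>"
  shows "integrable lborel (\<lambda>t. (dens t * w_fun \<sigma> t) *\<^sub>R \<phi> t)"
    "integrable lborel (\<lambda>t. (dens t * w_fun \<sigma> t) *\<^sub>R \<phi>' t)"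
    "integrable lborel (\<lambda>t. (dens t * w_fun \<sigma> t) *\<^sub>R (tanh t *\<^sub>R \<phi> t))"
    "integrable lborel (\<lambda>t. (dens t * w_fun \<sigma> t) *\<^sub>R (tanh t *\<^sub>R \<phi>' t))"
proof -
  obtain B where B: "\<And>t. norm (\<phi> t) \<le> B" "\<And>t. norm (\<phi>' t) \<le> B"
    using \<phi>_bounded by blast
  show "integrable lborel (\<lambda>t. (dens t * w_fun \<sigma> t) *\<^sub>R \<phi> t)"
    by (rule integrable_dens_w[OF assms continuous_\<phi> B(1)])
  show "integrable lborel (\<lambda>t. (dens t * w_fun \<sigma> t) *\<^sub>R \<phi>' t)"
    by (rule integrable_dens_w[OF assms continuous_\<phi>' B(2)])
  show "integrable lborel (\<lambda>t. (dens t * w_fun \<sigma> t) *\<^sub>R (tanh t *\<^sub>R \<phi> t))"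
    by (rule integrable_dens_w[OF assms continuous_tanh_scaleR_\<phi>(1) order_trans[OF norm_tanh_scaleR_le B(1)]])
  show "integrable lborel (\<lambda>t. (dens t * w_fun \<sigma> t) *\<^sub>R (tanh t *\<^sub>R \<phi>' t))"
    by (rule integrable_dens_w[OF assms continuous_tanh_scaleR_\<phi>(2) order_trans[OF norm_tanh_scaleR_le B(2)]])
qed

section \<open>Recurrence for the transform of the weights\<close>

text \<open>The transform of \<open>w_fun \<sigma>\<close> for \<open>\<sigma> > 2 * \<rho>\<close>,
  by \<open>transform_w_fun\<close>; only the even part of the kernel appears.\<close>

definition T :: "real \<Rightarrow> complex" where
  "T \<sigma> = (LINT t|lborel. (dens t * w_fun \<sigma> t) *\<^sub>R \<phi> t)"

text \<open>The integral through which the odd part of the kernel acts on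
  \<open>w_fun \<sigma> t * tanh t\<close>.\<close>

definition U :: "real \<Rightarrow> complex" where
  "U \<sigma> = (LINT t|lborel. (dens t * w_fun \<sigma> t) *\<^sub>R (tanh t *\<^sub>R \<phi>' t))"

text \<open>Integrates the derivative of \<open>dens * w_fun \<sigma> * \<phi>'\<close>, where the
  derivative falls once on the weight and once on \<open>dens * \<phi>'\<close>.\<close>

lemma U_eq_T:
  assumes \<sigma>: "\<sigma> > 2 * \<rho>"
  shows "of_real \<sigma> * U \<sigma> = - of_real \<kappa> * T \<sigma>"
proof -
  obtain B where B: "\<And>t. norm (\<phi> t) \<le> B" "\<And>t. norm (\<phi>' t) \<le> B"
    using \<phi>_bounded by blast
  let ?f = "\<lambda>t. (- \<sigma>) *\<^sub>R ((dens t * w_fun \<sigma> t) *\<^sub>R (tanh t *\<^sub>R \<phi>' t)) - \<kappa> *\<^sub>R ((dens t * w_fun \<sigma> t) *\<^sub>R \<phi> t)"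
  have "(LINT t|lborel. ?f t) = 0"
  proof (rule LINT_total_derivative_eq_0)
    let ?F = "\<lambda>t. (dens t * w_fun \<sigma> t) *\<^sub>R \<phi>' t"
    show "continuous_on UNIV ?F"
      by (intro continuous_intros continuous_dens continuous_w_fun)
    show "integrable lborel ?f"
      by (intro Bochner_Integration.integrable_diff integrable_scaleR_right integrable_\<phi> \<sigma>)
    show "(?F \<longlongrightarrow> 0) at_top" "(?F \<longlongrightarrow> 0) at_bot"
      by (rule tendsto_dens_w[OF \<sigma> B(2)], simp add: at_top_le_at_infinity at_bot_le_at_infinity)+
    fix t :: real assume "t \<noteq> 0"
    from has_vector_derivative_scaleR[OF DERIV_w_fun has_vector_derivative_dens_\<phi>'[OF this], of \<sigma>]
    show "(?F has_vector_derivative ?f t) (at t)"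
      by (simp add: algebra_simps)
  qed
  then have "(- \<sigma>) *\<^sub>R U \<sigma> - \<kappa> *\<^sub>R T \<sigma> = 0"
    unfolding U_def T_def
    by (simp only: Bochner_Integration.integral_diff integrable_scaleR_right integrable_\<phi>[OF \<sigma>] integral_scaleR_right)
  then show ?thesis by (simp add: scaleR_conv_of_real eq_neg_iff_add_eq_0 neg_eq_iff_add_eq_0 add.commute)
qed

text \<open>Integrates the derivative of \<open>dens * w_fun \<sigma> * tanh * \<phi>\<close>.
  Together with \<open>U_eq_T\<close> this is the symmetry of the radial operator, tested on
  \<open>w_fun \<sigma>\<close> and \<open>\<phi>\<close>.\<close>

lemma T_add_2:
  assumes \<sigma>: "\<sigma> > 2 * \<rho>"
  shows "of_real (2 * \<rho> - \<sigma>) * T \<sigma> + of_real (\<sigma> + 1 - \<iota>) * T (\<sigma> + 2) + U \<sigma> = 0"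
proof -
  obtain B where B: "\<And>t. norm (\<phi> t) \<le> B" "\<And>t. norm (\<phi>' t) \<le> B"
    using \<phi>_bounded by blast
  have \<sigma>2: "\<sigma> + 2 > 2 * \<rho>" using \<sigma> by simp
  let ?f = "\<lambda>t. (2 * \<rho> - \<sigma>) *\<^sub>R ((dens t * w_fun \<sigma> t) *\<^sub>R \<phi> t)
      + (\<sigma> + 1 - \<iota>) *\<^sub>R ((dens t * w_fun (\<sigma> + 2) t) *\<^sub>R \<phi> t)
      + (dens t * w_fun \<sigma> t) *\<^sub>R (tanh t *\<^sub>R \<phi>' t)"
  have "(LINT t|lborel. ?f t) = 0"
  proof (rule LINT_total_derivative_eq_0)
    let ?F = "\<lambda>t. (dens t * w_fun \<sigma> t) *\<^sub>R (tanh t *\<^sub>R \<phi> t)"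
    show "continuous_on UNIV ?F"
      by (intro continuous_on_scaleR continuous_on_mult continuous_dens continuous_w_fun continuous_tanh_scaleR_\<phi>)
    show "integrable lborel ?f"
      by (intro Bochner_Integration.integrable_add integrable_scaleR_right integrable_\<phi> \<sigma> \<sigma>2)
    show "(?F \<longlongrightarrow> 0) at_top" "(?F \<longlongrightarrow> 0) at_bot"
      by (rule tendsto_dens_w[OF \<sigma> order_trans[OF norm_tanh_scaleR_le B(1)]],
          simp add: at_top_le_at_infinity at_bot_le_at_infinity)+
    fix t :: real assume "t \<noteq> 0"
    from has_vector_derivative_scaleR[OF DERIV_dens_w_tanh[OF this] has_vector_derivative_\<phi>, of \<sigma>]
    show "(?F has_vector_derivative ?f t) (at t)"
      by (simp add: algebra_simps)
  qed
  moreover have "(LINT t|lborel. ?f t) = (2 * \<rho> - \<sigma>) *\<^sub>R T \<sigma> + (\<sigma> + 1 - \<iota>) *\<^sub>R T (\<sigma> + 2) + U \<sigma>"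
    unfolding U_def T_def
    by (simp only: Bochner_Integration.integral_add Bochner_Integration.integrable_add integrable_scaleR_right
        integrable_\<phi>[OF \<sigma>] integrable_\<phi>[OF \<sigma>2] integral_scaleR_right)
  ultimately show ?thesis by (simp add: scaleR_conv_of_real)
qed

text \<open>Eliminating \<open>U\<close> leaves a first-order recurrence with step 2, whose
  numerator \<open>s * (s - 2 * \<rho>) + \<kappa>\<close> factors as
  \<open>(s - \<rho> + \<nu>) * (s - \<rho> - \<nu>)\<close>.\<close>

lemma T_add_even:
  assumes \<sigma>: "\<sigma> > 2 * \<rho>"
  shows "T (\<sigma> + 2 * real k) = T \<sigma> *
     (pochhammer ((of_real (\<sigma> - \<rho>) + \<nu>) / 2) k * pochhammer ((of_real (\<sigma> - \<rho>) - \<nu>) / 2) k /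
      (pochhammer (of_real (\<sigma> / 2)) k * pochhammer (of_real ((\<sigma> + 1 - \<iota>) / 2)) k))"
proof (induction k)
  case 0
  then show ?case by simp
next
  case (Suc k)
  define s where "s = \<sigma> + 2 * real k"
  have s: "s > 2 * \<rho>" using \<sigma> by (simp add: s_def)
  have pos: "s > 0" "s + 1 - \<iota> > 0"
    using s \<rho>_pos b_pos \<iota>_pos by (auto simp: rho_def)
  \<comment> \<open>Halving all four factors turns the step 2 in \<open>\<sigma>\<close> into the
    unit step of a Pochhammer symbol.\<close>
  have alg: "z = w * ((A / 2 * (B / 2)) / (X / 2 * (Y / 2)))"
    if "X * Y * z = A * B * w" "X \<noteq> 0" "Y \<noteq> 0" for A B X Y z w :: complex
    using that by (simp add: divide_simps mult_ac)
  have "of_real (s + 1 - \<iota>) * T (s + 2) = of_real (s - 2 * \<rho>) * T s - U s"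
    using T_add_2[OF s] by (simp add: algebra_simps)
  then have "of_real s * of_real (s + 1 - \<iota>) * T (s + 2) = of_real s * (of_real (s - 2 * \<rho>) * T s - U s)"
    by (simp only: mult.assoc)
  also have "\<dots> = (of_real s * of_real (s - 2 * \<rho>) + of_real \<kappa>) * T s"
    using U_eq_T[OF s] by (simp add: algebra_simps)
  also have "of_real s * of_real (s - 2 * \<rho>) + of_real \<kappa> = (of_real (s - \<rho>) + \<nu>) * (of_real (s - \<rho>) - \<nu>)"
    unfolding of_real_\<kappa> by (simp add: algebra_simps power2_eq_square)
  finally have prod: "of_real s * of_real (s + 1 - \<iota>) * T (s + 2) =
      (of_real (s - \<rho>) + \<nu>) * (of_real (s - \<rho>) - \<nu>) * T s" .
  have step: "T (s + 2) = T s * (((of_real (s - \<rho>) + \<nu>) / 2 * ((of_real (s - \<rho>) - \<nu>) / 2)) /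
      (of_real (s / 2) * of_real ((s + 1 - \<iota>) / 2)))"
    unfolding of_real_divide of_real_numeral
    by (rule alg[OF prod]) (use pos in \<open>simp_all only: of_real_eq_0_iff less_imp_neq[symmetric] not_False_eq_True\<close>)
  have "T (\<sigma> + 2 * real (Suc k)) = T (s + 2)" by (simp add: s_def algebra_simps)
  also note step
  also have "(of_real (s - \<rho>) + \<nu>) / 2 = (of_real (\<sigma> - \<rho>) + \<nu>) / 2 + of_nat k"
    by (simp add: s_def field_simps)
  also have "(of_real (s - \<rho>) - \<nu>) / 2 = (of_real (\<sigma> - \<rho>) - \<nu>) / 2 + of_nat k"
    by (simp add: s_def field_simps)
  also have "of_real (s / 2) = (of_real (\<sigma> / 2) + of_nat k :: complex)"
    by (simp add: s_def field_simps)
  also have "of_real ((s + 1 - \<iota>) / 2) = (of_real ((\<sigma> + 1 - \<iota>) / 2) + of_nat k :: complex)"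
    by (simp add: s_def field_simps)
  finally show ?case
    by (simp only: Suc.IH[folded s_def] pochhammer_Suc times_divide_times_eq mult_ac)
qed

section \<open>Transforms of the weights and of their products with tanh\<close>

lemma mu_eq: "mu b \<iota> = density lborel (\<lambda>t. ennreal (dens t))"
  by (simp add: mu_def dens_def)

lemma dens_measurable [measurable]: "dens \<in> borel_measurable borel"
  by (intro borel_measurable_continuous_onI continuous_dens)

lemma LINT_mu:
  fixes f :: "real \<Rightarrow> complex"
  assumes "continuous_on UNIV f"
  shows "(LINT t|mu b \<iota>. f t) = (LINT t|lborel. dens t *\<^sub>R f t)"
    "integrable (mu b \<iota>) f \<longleftrightarrow> integrable lborel (\<lambda>t. dens t *\<^sub>R f t)"
proof -
  have [measurable]: "f \<in> borel_measurable borel"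
    using assms by (rule borel_measurable_continuous_onI)
  show "(LINT t|mu b \<iota>. f t) = (LINT t|lborel. dens t *\<^sub>R f t)"
    unfolding mu_eq by (rule integral_density) (auto simp: dens_nonneg)
  show "integrable (mu b \<iota>) f \<longleftrightarrow> integrable lborel (\<lambda>t. dens t *\<^sub>R f t)"
    unfolding mu_eq by (rule integrable_density) (auto simp: dens_nonneg)
qed

lemma G_fun_eq: "G_fun b \<iota> \<nu> t = \<phi> t - \<phi>' t / (\<nu> + of_real \<rho>)"
  by (simp add: G_fun_def Let_def \<phi>_def \<phi>'_def \<Phi>_def arg_def scaleR_conv_of_real)

lemma G_fun_sign:
  assumes "\<epsilon> \<in> {1, - 1 :: real}"
  shows "G_fun b \<iota> \<nu> (\<epsilon> * t) = \<phi> t - (of_real \<epsilon> / (\<nu> + of_real \<rho>)) * \<phi>' t"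
  using assms by (auto simp: G_fun_eq)

text \<open>The weight is even, so the odd part of the kernel integrates to 0 and the sign
  \<open>\<epsilon>\<close> disappears.\<close>

lemma transform_w_fun:
  assumes \<sigma>: "\<sigma> > 2 * \<rho>" and \<epsilon>: "\<epsilon> \<in> {1, -1}"
  shows "integrable (mu b \<iota>) (\<lambda>t. of_real (w_fun \<sigma> t) * G_fun b \<iota> \<nu> (\<epsilon> * t))"
    and "cherednik_opdam b \<iota> \<epsilon> (\<lambda>t. of_real (w_fun \<sigma> t)) \<nu> = T \<sigma>"
proof -
  define c where "c = of_real \<epsilon> / (\<nu> + of_real \<rho>)"
  have cont: "continuous_on UNIV (\<lambda>t. of_real (w_fun \<sigma> t) * (\<phi> t - c * \<phi>' t))"
    by (intro continuous_intros continuous_w_fun)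
  have eq: "(\<lambda>t. dens t *\<^sub>R (of_real (w_fun \<sigma> t) * (\<phi> t - c * \<phi>' t))) =
      (\<lambda>t. (dens t * w_fun \<sigma> t) *\<^sub>R \<phi> t - c * ((dens t * w_fun \<sigma> t) *\<^sub>R \<phi>' t))"
    by (simp add: fun_eq_iff scaleR_conv_of_real algebra_simps)
  show "integrable (mu b \<iota>) (\<lambda>t. of_real (w_fun \<sigma> t) * G_fun b \<iota> \<nu> (\<epsilon> * t))"
    unfolding G_fun_sign[OF \<epsilon>] c_def[symmetric] LINT_mu(2)[OF cont] eq
    by (intro Bochner_Integration.integrable_diff integrable_mult_right integrable_\<phi> \<sigma>)
  have "(LINT t|lborel. (dens t * w_fun \<sigma> t) *\<^sub>R \<phi>' t) = 0"
    by (rule LINT_odd_eq_0) simp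
  then show "cherednik_opdam b \<iota> \<epsilon> (\<lambda>t. of_real (w_fun \<sigma> t)) \<nu> = T \<sigma>"
    unfolding cherednik_opdam_def G_fun_sign[OF \<epsilon>] c_def[symmetric] LINT_mu(1)[OF cont] eq T_def
    by (simp only: Bochner_Integration.integral_diff integrable_mult_right integrable_\<phi>[OF \<sigma>] integral_mult_right_zero) simp
qed

text \<open>Here only the odd part of the kernel survives. By \<open>U_eq_T\<close> it contributes
  \<open>\<nu>\<^sup>2 - \<rho>\<^sup>2\<close>, whose factor \<open>\<nu> + \<rho>\<close> cancels
  the denominator in the kernel; \<open>\<nu> - \<rho>\<close> remains.\<close>

lemma transform_w_fun_tanh:
  assumes \<sigma>: "\<sigma> > 2 * \<rho>" and \<epsilon>: "\<epsilon> \<in> {1, -1}"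
  shows "integrable (mu b \<iota>) (\<lambda>t. of_real (w_fun \<sigma> t * tanh t) * G_fun b \<iota> \<nu> (\<epsilon> * t))"
    and "cherednik_opdam b \<iota> \<epsilon> (\<lambda>t. of_real (w_fun \<sigma> t * tanh t)) \<nu> =
           - (of_real \<epsilon> * (\<nu> - of_real \<rho>) / of_real \<sigma>) * T \<sigma>"
proof -
  define c where "c = of_real \<epsilon> / (\<nu> + of_real \<rho>)"
  have cont: "continuous_on UNIV (\<lambda>t. of_real (w_fun \<sigma> t * tanh t) * (\<phi> t - c * \<phi>' t))"
    by (intro continuous_intros continuous_w_fun) auto
  have eq: "(\<lambda>t. dens t *\<^sub>R (of_real (w_fun \<sigma> t * tanh t) * (\<phi> t - c * \<phi>' t))) =
      (\<lambda>t. (dens t * w_fun \<sigma> t) *\<^sub>R (tanh t *\<^sub>R \<phi> t) - c * ((dens t * w_fun \<sigma> t) *\<^sub>R (tanh t *\<^sub>R \<phi>' t)))"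
    by (simp add: fun_eq_iff scaleR_conv_of_real algebra_simps)
  show "integrable (mu b \<iota>) (\<lambda>t. of_real (w_fun \<sigma> t * tanh t) * G_fun b \<iota> \<nu> (\<epsilon> * t))"
    unfolding G_fun_sign[OF \<epsilon>] c_def[symmetric] LINT_mu(2)[OF cont] eq
    by (intro Bochner_Integration.integrable_diff integrable_mult_right integrable_\<phi> \<sigma>)
  have 0: "(LINT t|lborel. (dens t * w_fun \<sigma> t) *\<^sub>R (tanh t *\<^sub>R \<phi> t)) = 0"
    by (rule LINT_odd_eq_0) simp
  have "cherednik_opdam b \<iota> \<epsilon> (\<lambda>t. of_real (w_fun \<sigma> t * tanh t)) \<nu> = - c * U \<sigma>"
    unfolding cherednik_opdam_def G_fun_sign[OF \<epsilon>] c_def[symmetric] LINT_mu(1)[OF cont] eq U_def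
    by (simp only: Bochner_Integration.integral_diff integrable_mult_right integrable_\<phi>[OF \<sigma>] integral_mult_right_zero 0) simp
  also have "U \<sigma> = (\<nu> + of_real \<rho>) * ((\<nu> - of_real \<rho>) / of_real \<sigma>) * T \<sigma>"
  proof -
    have "\<sigma> > 0" using \<sigma> \<rho>_pos by simp
    then show ?thesis
      using U_eq_T[OF \<sigma>] unfolding of_real_\<kappa> by (simp add: field_simps power2_eq_square)
  qed
  finally show "cherednik_opdam b \<iota> \<epsilon> (\<lambda>t. of_real (w_fun \<sigma> t * tanh t)) \<nu> =
           - (of_real \<epsilon> * (\<nu> - of_real \<rho>) / of_real \<sigma>) * T \<sigma>"
    using \<nu>_plus_\<rho>_nonzero by (simp add: c_def)
qed

end

section \<open>Jacobi type functions\<close>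

text \<open>The symbol \<open>pochhammer (- of_nat n) k\<close> vanishes for \<open>k > n\<close>,
  so the series terminates.\<close>

lemma hypergeom_minus_of_nat:
  "hypergeom (- of_nat n # as) bs x =
     (\<Sum>k\<le>n. (\<Prod>a\<leftarrow>- of_nat n # as. pochhammer a k) / (\<Prod>b\<leftarrow>bs. pochhammer b k) * (x ^ k / fact k))"
  unfolding hypergeom_eq_suminf
  by (rule suminf_finite) (auto simp: pochhammer_of_nat_eq_0_lemma)

lemma pochhammer_of_real: "pochhammer (of_real x) n = (of_real (pochhammer x n) :: complex)"
  by (simp add: pochhammer_prod)

lemma of_real_jacobi_coeff:
  "of_real (jacobi_coeff n \<alpha> \<beta> k) = of_real (pochhammer (\<alpha> + 1) n / fact n) *
     (pochhammer (- of_nat n) k * pochhammer (of_real (of_nat n + \<alpha> + \<beta> + 1)) k /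
       (pochhammer (of_real (\<alpha> + 1)) k * fact k) :: complex)"
proof -
  have "(- of_nat n :: complex) = of_real (- of_nat n)" by simp
  then show ?thesis
    unfolding pochhammer_of_real jacobi_coeff_def by (simp only: pochhammer_of_real) simp
qed

lemma cherednik_opdam_sum:
  assumes "finite A"
    and "\<And>k. k \<in> A \<Longrightarrow> integrable (mu b \<iota>) (\<lambda>t. f k t * G_fun b \<iota> \<nu> (\<epsilon> * t))"
  shows "cherednik_opdam b \<iota> \<epsilon> (\<lambda>t. \<Sum>k\<in>A. c k * f k t) \<nu> = (\<Sum>k\<in>A. c k * cherednik_opdam b \<iota> \<epsilon> (f k) \<nu>)"
proof -
  have "cherednik_opdam b \<iota> \<epsilon> (\<lambda>t. \<Sum>k\<in>A. c k * f k t) \<nu> =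
      (LINT t|mu b \<iota>. (\<Sum>k\<in>A. c k * (f k t * G_fun b \<iota> \<nu> (\<epsilon> * t))))"
    by (simp add: cherednik_opdam_def sum_distrib_right mult.assoc)
  also have "\<dots> = (\<Sum>k\<in>A. LINT t|mu b \<iota>. c k * (f k t * G_fun b \<iota> \<nu> (\<epsilon> * t)))"
    using assms(2) by (intro Bochner_Integration.integral_sum integrable_mult_right) auto
  finally show ?thesis by (simp add: cherednik_opdam_def)
qed

context jacobi_function
begin

text \<open>At \<open>x = 2 * (tanh t)\<^sup>2 - 1\<close> the expansion variable
  \<open>(1 - x) / 2\<close> equals \<open>1 - (tanh t)\<^sup>2\<close>, and each factor of it
  raises the exponent of the weight by 2.\<close>

lemma Q_plus_eq:
  assumes "sigma0 b \<iota> \<sigma> > - 1"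
  shows "Q_plus b \<iota> \<sigma> n t =
    (\<Sum>k\<le>n. jacobi_coeff n (sigma0 b \<iota> \<sigma>) (delta0 b \<iota>) k * w_fun (\<sigma> + 2 * real k) t)"
proof -
  have d: "delta0 b \<iota> > -1" using b_pos \<iota>_pos by (simp add: delta0_def field_simps)
  have eq: "(1 - (2 * (tanh t)\<^sup>2 - 1)) / 2 = 1 - (tanh t)\<^sup>2" by (simp add: field_simps)
  show ?thesis
    unfolding Q_plus_def jacobi_poly_eq_explicit[OF assms d] poly_jacobi_explicit eq w_fun_add_2
    by (simp add: sum_distrib_left mult_ac)
qed

lemma Q_minus_eq:
  assumes "sigma0 b \<iota> \<sigma> > - 1"
  shows "Q_minus b \<iota> \<sigma> n t =
    (\<Sum>k\<le>n. jacobi_coeff n (sigma0 b \<iota> \<sigma>) (delta1 b \<iota>) k * (w_fun (\<sigma> + 2 * real k) t * tanh t))"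
proof -
  have d: "delta1 b \<iota> > -1" using b_pos \<iota>_pos by (simp add: delta1_def delta0_def field_simps)
  have eq: "(1 - (2 * (tanh t)\<^sup>2 - 1)) / 2 = 1 - (tanh t)\<^sup>2" by (simp add: field_simps)
  show ?thesis
    unfolding Q_minus_def jacobi_poly_eq_explicit[OF assms d] poly_jacobi_explicit eq w_fun_add_2
    by (simp add: sum_distrib_left sum_distrib_right mult_ac)
qed

lemma even_transform_w_fun:
  assumes "\<sigma> > 2 * \<rho>"
  shows "even_transform b \<iota> (\<lambda>t. of_real (w_fun \<sigma> t)) \<nu> = T \<sigma>"
  unfolding even_transform_def by (rule transform_w_fun(2)[OF assms]) simp

text \<open>Termwise, the Jacobi coefficients supply the parameters \<open>- n\<close>,
  \<open>n + \<sigma>0 + \<delta>0 + 1\<close> and \<open>\<sigma>0 + 1\<close> of the 4F3, and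
  \<open>T_add_even\<close> supplies the other four.\<close>

lemma transform_Q_plus:
  assumes \<sigma>: "\<sigma> > 2 * \<rho>" and \<epsilon>: "\<epsilon> \<in> {1, -1}"
  shows "cherednik_opdam b \<iota> \<epsilon> (\<lambda>t. of_real (Q_plus b \<iota> \<sigma> n t)) \<nu> =
       of_real (pochhammer (sigma0 b \<iota> \<sigma> + 1) n / fact n) * T \<sigma>
       * hypergeom
           [- of_nat n,
            of_real (of_nat n + sigma0 b \<iota> \<sigma> + delta0 b \<iota> + 1),
            (of_real (\<sigma> - \<rho>) + \<nu>) / 2,
            (of_real (\<sigma> - \<rho>) - \<nu>) / 2]
           [of_real (sigma0 b \<iota> \<sigma> + 1),
            of_real (\<sigma> / 2),
            of_real ((\<sigma> + 1 - \<iota>) / 2)]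
           1"
proof -
  have \<sigma>k: "\<sigma> + 2 * real k > 2 * \<rho>" for k using \<sigma> by (simp add: add_strict_increasing2 add.commute)
  have s0: "sigma0 b \<iota> \<sigma> > - 1"
    using \<sigma> b_pos \<iota>_pos by (simp add: sigma0_def rho_def)
  have "cherednik_opdam b \<iota> \<epsilon> (\<lambda>t. of_real (Q_plus b \<iota> \<sigma> n t)) \<nu> =
      cherednik_opdam b \<iota> \<epsilon> (\<lambda>t. \<Sum>k\<le>n. of_real (jacobi_coeff n (sigma0 b \<iota> \<sigma>) (delta0 b \<iota>) k)
        * of_real (w_fun (\<sigma> + 2 * real k) t)) \<nu>"
    by (simp add: Q_plus_eq[OF s0])
  also have "\<dots> = (\<Sum>k\<le>n. of_real (jacobi_coeff n (sigma0 b \<iota> \<sigma>) (delta0 b \<iota>) k) * T (\<sigma> + 2 * real k))"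
    by (subst cherednik_opdam_sum) (simp_all only: transform_w_fun[OF \<sigma>k \<epsilon>] finite_atMost)
  finally show ?thesis
    unfolding T_add_even[OF \<sigma>] of_real_jacobi_coeff hypergeom_minus_of_nat sum_distrib_left
    by (simp add: mult_ac del: of_real_add of_real_diff of_real_divide)
qed

text \<open>Compared with \<open>transform_Q_plus\<close>, each term has an additional divisor
  \<open>\<sigma> + 2 * real k\<close>, which raises the lower parameter \<open>\<sigma> / 2\<close>
  by 1 and leaves \<open>1 / \<sigma>\<close> in front.\<close>

lemma transform_Q_minus:
  assumes \<sigma>: "\<sigma> > 2 * \<rho>" and \<epsilon>: "\<epsilon> \<in> {1, -1}"
  shows "cherednik_opdam b \<iota> \<epsilon> (\<lambda>t. of_real (Q_minus b \<iota> \<sigma> n t)) \<nu> =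
       - of_real (pochhammer (sigma0 b \<iota> \<sigma> + 1) n / (fact n * \<sigma>)) * T \<sigma>
       * (of_real \<epsilon> * (\<nu> - of_real \<rho>))
       * hypergeom
           [- of_nat n,
            of_real (of_nat n + sigma0 b \<iota> \<sigma> + delta1 b \<iota> + 1),
            (of_real (\<sigma> - \<rho>) + \<nu>) / 2,
            (of_real (\<sigma> - \<rho>) - \<nu>) / 2]
           [of_real (sigma0 b \<iota> \<sigma> + 1),
            of_real (\<sigma> / 2 + 1),
            of_real ((\<sigma> + 1 - \<iota>) / 2)]
           1"
proof -
  have \<sigma>k: "\<sigma> + 2 * real k > 2 * \<rho>" for k using \<sigma> by (simp add: add_strict_increasing2 add.commute)
  have s0: "sigma0 b \<iota> \<sigma> > - 1"
    using \<sigma> b_pos \<iota>_pos by (simp add: sigma0_def rho_def)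
  \<comment> \<open>With \<open>x = \<sigma> / 2\<close>, both
    \<open>pochhammer x k * (x + k)\<close> and \<open>x * pochhammer (x + 1) k\<close> are the
    Pochhammer symbol of length \<open>k + 1\<close>.\<close>
  have shift: "pochhammer (of_real (\<sigma> / 2)) k * of_real (\<sigma> + 2 * real k)
      = of_real \<sigma> * (pochhammer (of_real (\<sigma> / 2 + 1)) k :: complex)" for k
  proof -
    have "pochhammer (\<sigma> / 2) k * (\<sigma> / 2 + real k) = \<sigma> / 2 * pochhammer (\<sigma> / 2 + 1) k"
      by (metis pochhammer_Suc pochhammer_rec)
    then have "pochhammer (\<sigma> / 2) k * (\<sigma> + 2 * real k) = \<sigma> * pochhammer (\<sigma> / 2 + 1) k"
      by (simp add: field_simps)
    then show ?thesis unfolding pochhammer_of_real by (metis of_real_mult)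
  qed
  have "cherednik_opdam b \<iota> \<epsilon> (\<lambda>t. of_real (Q_minus b \<iota> \<sigma> n t)) \<nu> =
      cherednik_opdam b \<iota> \<epsilon> (\<lambda>t. \<Sum>k\<le>n. of_real (jacobi_coeff n (sigma0 b \<iota> \<sigma>) (delta1 b \<iota>) k)
        * of_real (w_fun (\<sigma> + 2 * real k) t * tanh t)) \<nu>"
    by (simp add: Q_minus_eq[OF s0])
  also have "\<dots> = (\<Sum>k\<le>n. of_real (jacobi_coeff n (sigma0 b \<iota> \<sigma>) (delta1 b \<iota>) k) *
      (- (of_real \<epsilon> * (\<nu> - of_real \<rho>) / of_real (\<sigma> + 2 * real k)) * T (\<sigma> + 2 * real k)))"
    by (subst cherednik_opdam_sum) (simp_all only: transform_w_fun_tanh[OF \<sigma>k \<epsilon>] finite_atMost)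
  also have "\<dots> = (\<Sum>k\<le>n. - of_real (pochhammer (sigma0 b \<iota> \<sigma> + 1) n / (fact n * \<sigma>)) * T \<sigma>
       * (of_real \<epsilon> * (\<nu> - of_real \<rho>)) *
      (pochhammer (- of_nat n) k * (pochhammer (of_real (of_nat n + sigma0 b \<iota> \<sigma> + delta1 b \<iota> + 1)) k *
        (pochhammer ((of_real (\<sigma> - \<rho>) + \<nu>) / 2) k * pochhammer ((of_real (\<sigma> - \<rho>) - \<nu>) / 2) k)) /
       (pochhammer (of_real (sigma0 b \<iota> \<sigma> + 1)) k * (pochhammer (of_real (\<sigma> / 2 + 1)) k *
         pochhammer (of_real ((\<sigma> + 1 - \<iota>) / 2)) k)) / fact k))"
  proof (rule sum.cong[OF refl])
    fix k
    have alg: "C / F * (p * q / (u * f)) * (- (e / S) * (X * (r * s / (v * w))))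
        = - (C / (F * Z)) * X * e * (p * (q * (r * s)) / (u * (v' * w)) / f)"
      if "v * S = Z * v'" for C F p q u f e S X r s v w Z v' :: complex
    proof -
      have "C / F * (p * q / (u * f)) * (- (e / S) * (X * (r * s / (v * w))))
          = - (C * p * q * e * X * r * s) / (F * u * f * w * (v * S))" by (simp add: mult_ac)
      also have "\<dots> = - (C / (F * Z)) * X * e * (p * (q * (r * s)) / (u * (v' * w)) / f)"
        unfolding that by (simp add: mult_ac)
      finally show ?thesis .
    qed
    show "of_real (jacobi_coeff n (sigma0 b \<iota> \<sigma>) (delta1 b \<iota>) k) *
      (- (of_real \<epsilon> * (\<nu> - of_real \<rho>) / of_real (\<sigma> + 2 * real k)) * T (\<sigma> + 2 * real k)) =
      - of_real (pochhammer (sigma0 b \<iota> \<sigma> + 1) n / (fact n * \<sigma>)) * T \<sigma>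
       * (of_real \<epsilon> * (\<nu> - of_real \<rho>)) *
      (pochhammer (- of_nat n) k * (pochhammer (of_real (of_nat n + sigma0 b \<iota> \<sigma> + delta1 b \<iota> + 1)) k *
        (pochhammer ((of_real (\<sigma> - \<rho>) + \<nu>) / 2) k * pochhammer ((of_real (\<sigma> - \<rho>) - \<nu>) / 2) k)) /
       (pochhammer (of_real (sigma0 b \<iota> \<sigma> + 1)) k * (pochhammer (of_real (\<sigma> / 2 + 1)) k *
         pochhammer (of_real ((\<sigma> + 1 - \<iota>) / 2)) k)) / fact k)"
      unfolding T_add_even[OF \<sigma>] of_real_jacobi_coeff of_real_divide[of _ "fact n"] of_real_divide[of _ "fact n * \<sigma>"] of_real_mult[of "fact n" \<sigma>]
      by (rule alg[OF shift])
  qed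
  finally show ?thesis
    unfolding hypergeom_minus_of_nat sum_distrib_left
    by (simp add: mult_ac del: of_real_add of_real_diff of_real_divide of_real_mult)
qed

end

text \<open>The second formula carries \<open>\<epsilon> * (\<nu> - \<rho>)\<close>: as
  \<open>Q_minus\<close> is odd, its two transforms are negatives of each other. At
  \<open>\<epsilon> = -1\<close> the factor is \<open>\<epsilon> * \<nu> + \<rho>\<close>.\<close>

theorem theorem4p1:
  fixes b \<iota> \<sigma> \<epsilon> :: real and n :: nat and \<nu> :: complex
  assumes "b > 0" and "\<iota> > 0" and "\<sigma> > 2 * (\<iota> + b)"
    and "Re \<nu> = 0"
    and "\<epsilon> \<in> {1, -1}"
  shows
    "cherednik_opdam b \<iota> \<epsilon> (\<lambda>t. of_real (Q_plus b \<iota> \<sigma> n t)) \<nu> =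
       of_real (pochhammer (sigma0 b \<iota> \<sigma> + 1) n / fact n)
       * even_transform b \<iota> (\<lambda>t. of_real (w_fun \<sigma> t)) \<nu>
       * hypergeom
           [- of_nat n,
            of_real (of_nat n + sigma0 b \<iota> \<sigma> + delta0 b \<iota> + 1),
            (of_real (\<sigma> - rho b \<iota>) + \<nu>) / 2,
            (of_real (\<sigma> - rho b \<iota>) - \<nu>) / 2]
           [of_real (sigma0 b \<iota> \<sigma> + 1),
            of_real (\<sigma> / 2),
            of_real ((\<sigma> + 1 - \<iota>) / 2)]
           1
     \<and>
     cherednik_opdam b \<iota> \<epsilon> (\<lambda>t. of_real (Q_minus b \<iota> \<sigma> n t)) \<nu> =
       - of_real (pochhammer (sigma0 b \<iota> \<sigma> + 1) n / (fact n * \<sigma>))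
       * even_transform b \<iota> (\<lambda>t. of_real (w_fun \<sigma> t)) \<nu>
       * (of_real \<epsilon> * (\<nu> - of_real (rho b \<iota>)))
       * hypergeom
           [- of_nat n,
            of_real (of_nat n + sigma0 b \<iota> \<sigma> + delta1 b \<iota> + 1),
            (of_real (\<sigma> - rho b \<iota>) + \<nu>) / 2,
            (of_real (\<sigma> - rho b \<iota>) - \<nu>) / 2]
           [of_real (sigma0 b \<iota> \<sigma> + 1),
            of_real (\<sigma> / 2 + 1),
            of_real ((\<sigma> + 1 - \<iota>) / 2)]
           1"
proof -
  interpret jacobi_function b \<iota> \<nu>
    using assms by unfold_locales
  have \<sigma>: "\<sigma> > 2 * rho b \<iota>" using assms(3) by (simp add: rho_def add.commute)
  show ?thesis
    unfolding even_transform_w_fun[OF \<sigma>]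
    using transform_Q_plus[OF \<sigma> assms(5)] transform_Q_minus[OF \<sigma> assms(5)] by (rule conjI)
qed

end
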